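(* Let $X$ be a shift space over a finite alphabet. If $X$ is synchronized and bi-balanced, then $X$ is intrinsically ergodic.
   Context: Let $\mathcal A$ be a finite alphabet. A shift space $X\subset\mathcal A^{\mathbb Z}$ is a nonempty closed set invariant under the left shift $\sigma$ (i.e. $\sigma(X)=X$). $\mathcal B_n(X)$ is the set of words of length $n$ occurring in points of $X$, with $\mathcal B_0(X)=\{\varepsilon\}$ ($\varepsilon$ the empty word), and $\mathcal B(X)=\bigcup_{n\ge 0}\mathcal B_n(X)$. For a word $w$ and an integer $n$, $[w]_n=\{x\in X: x_{[n,n+|w|-1]}=w\}$. $X$ is irreducible if for every ordered pair $u,v\in\mathcal B(X)$ there is $w\in\mathcal B(X)$ with $uwv\in\mathcal B(X)$. A word $w\in\mathcal B(X)$ is synchronizing if whenever $uw\in\mathcal B(X)$ and $wv\in\mathcal B(X)$ we have $uwv\in\mathcal B(X)$. An irreducible shift space with a synchronizing word is called synchronized. For $u\in\mathcal B(X)$ and $n\ge 0$, let $\mathcal F_n(u,X)=\{w\in\mathcal B_n(X): uw\in\mathcal B(X)\}$ and $\mathcal P_n(u,X)=\{w\in\mathcal B_n(X): wu\in\mathcal B(X)\}$. $X$ is right-balanced if there is $c>0$ such that $|\mathcal F_n(u,X)|/|\mathcal B_n(X)|\ge c$ for all $u\in\mathcal B(X)$ and $n\ge 1$; left-balanced if there is $c>0$ such that $|\mathcal P_n(u,X)|/|\mathcal B_n(X)|\ge c$ for all $u\in\mathcal B(X)$ and $n\ge1$; bi-balanced if it is both right- and left-balanced. The topological entropy is $h(X)=\lim_{n\to\infty}\frac1n\log|\mathcal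 B_n(X)|$. For a $\sigma$-invariant Borel probability measure $\mu$ on $X$, the measure-theoretic entropy is $h_\mu(X)=-\lim_{n\to\infty}\frac1n\sum_{w\in\mathcal B_n(X)}\mu([w]_0)\log\mu([w]_0)$ (with $0\log 0=0$). A measure of maximal entropy of $X$ is a $\sigma$-invariant Borel probability measure $\mu$ on $X$ with $h_\mu(X)=h(X)$. $X$ is intrinsically ergodic if it admits exactly one measure of maximal entropy. *)

theory Defs
  imports "HOL-Probability.Probability"
begin

text \<open>The alphabet is the finite type \<open>'a\<close>; points are bi-infinite sequences \<open>int \<Rightarrow> 'a\<close>,
  and finite words are lists.\<close>

definition left_shift :: "(int \<Rightarrow> 'a) \<Rightarrow> int \<Rightarrow> 'a" where
  "left_shift x = (\<lambda>i. x (i + 1))"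

definition full_shift_topology :: "(int \<Rightarrow> 'a) topology" where
  "full_shift_topology = product_topology (\<lambda>_. discrete_topology UNIV) UNIV"

definition shift_space :: "(int \<Rightarrow> 'a::finite) set \<Rightarrow> bool" where
  "shift_space X \<longleftrightarrow> X \<noteq> {} \<and> closedin full_shift_topology X \<and> left_shift ` X = X"

text \<open>\<open>subword x i n\<close> is the word $x_{[i,\,i+n-1]}$ of length \<open>n\<close>.\<close>

definition subword :: "(int \<Rightarrow> 'a) \<Rightarrow> int \<Rightarrow> nat \<Rightarrow> 'a list" where
  "subword x i n = map (\<lambda>k. x (i + int k)) [0..<n]"

definition words_of_length :: "nat \<Rightarrow> (int \<Rightarrow> 'a) set \<Rightarrow> 'a list set" where
  "words_of_length n X = {subword x i n | x i. x \<in> X}"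

definition language :: "(int \<Rightarrow> 'a) set \<Rightarrow> 'a list set" where
  "language X = (\<Union>n. words_of_length n X)"

definition cylinder :: "(int \<Rightarrow> 'a) set \<Rightarrow> 'a list \<Rightarrow> int \<Rightarrow> (int \<Rightarrow> 'a) set" where
  "cylinder X w n = {x \<in> X. subword x n (length w) = w}"

definition irreducible_shift :: "(int \<Rightarrow> 'a) set \<Rightarrow> bool" where
  "irreducible_shift X \<longleftrightarrow>
     (\<forall>u \<in> language X. \<forall>v \<in> language X. \<exists>w \<in> language X. u @ w @ v \<in> language X)"

definition synchronizing_word :: "(int \<Rightarrow> 'a) set \<Rightarrow> 'a list \<Rightarrow> bool" where
  "synchronizing_word X w \<longleftrightarrow> w \<in> language X \<and>
     (\<forall>u v. u @ w \<in> language X \<longrightarrow> w @ v \<in> language X \<longrightarrow> u @ w @ v \<in> language X)"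

definition synchronized_shift :: "(int \<Rightarrow> 'a::finite) set \<Rightarrow> bool" where
  "synchronized_shift X \<longleftrightarrow>
     shift_space X \<and> irreducible_shift X \<and> (\<exists>w. synchronizing_word X w)"

definition follower_words :: "nat \<Rightarrow> 'a list \<Rightarrow> (int \<Rightarrow> 'a) set \<Rightarrow> 'a list set" where
  "follower_words n u X = {w \<in> words_of_length n X. u @ w \<in> language X}"

definition predecessor_words :: "nat \<Rightarrow> 'a list \<Rightarrow> (int \<Rightarrow> 'a) set \<Rightarrow> 'a list set" where
  "predecessor_words n u X = {w \<in> words_of_length n X. w @ u \<in> language X}"

definition right_balanced :: "(int \<Rightarrow> 'a) set \<Rightarrow> bool" where
  "right_balanced X \<longleftrightarrow> (\<exists>c::real. c > 0 \<and> (\<forall>u \<in> language X. \<forall>n \<ge> 1.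
     real (card (follower_words n u X)) / real (card (words_of_length n X)) \<ge> c))"

definition left_balanced :: "(int \<Rightarrow> 'a) set \<Rightarrow> bool" where
  "left_balanced X \<longleftrightarrow> (\<exists>c::real. c > 0 \<and> (\<forall>u \<in> language X. \<forall>n \<ge> 1.
     real (card (predecessor_words n u X)) / real (card (words_of_length n X)) \<ge> c))"

definition bi_balanced :: "(int \<Rightarrow> 'a) set \<Rightarrow> bool" where
  "bi_balanced X \<longleftrightarrow> right_balanced X \<and> left_balanced X"

definition topological_entropy :: "(int \<Rightarrow> 'a) set \<Rightarrow> real" where
  "topological_entropy X = lim (\<lambda>n. 1 / real n * ln (real (card (words_of_length n X))))"

definition shift_borel :: "(int \<Rightarrow> 'a) set \<Rightarrow> (int \<Rightarrow> 'a) measure" where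
  "shift_borel X = sigma X {U. openin (subtopology full_shift_topology X) U}"

text \<open>The equation on \<open>sets\<close> also forces \<open>space \<mu> = X\<close>.\<close>

definition invariant_prob_measure :: "(int \<Rightarrow> 'a) set \<Rightarrow> (int \<Rightarrow> 'a) measure \<Rightarrow> bool" where
  "invariant_prob_measure X \<mu> \<longleftrightarrow>
     prob_space \<mu> \<and> sets \<mu> = sets (shift_borel X) \<and>
     (\<forall>E \<in> sets \<mu>. emeasure \<mu> (left_shift -` E \<inter> X) = emeasure \<mu> E)"

text \<open>The convention $0 \log 0 = 0$ is automatic, since the product with 0 is 0.\<close>

definition measure_theoretic_entropy :: "(int \<Rightarrow> 'a) set \<Rightarrow> (int \<Rightarrow> 'a) measure \<Rightarrow> real" where
  "measure_theoretic_entropy X \<mu> =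
     - lim (\<lambda>n. 1 / real n * (\<Sum>w \<in> words_of_length n X.
         measure \<mu> (cylinder X w 0) * ln (measure \<mu> (cylinder X w 0))))"

definition measure_of_maximal_entropy :: "(int \<Rightarrow> 'a) set \<Rightarrow> (int \<Rightarrow> 'a) measure \<Rightarrow> bool" where
  "measure_of_maximal_entropy X \<mu> \<longleftrightarrow>
     invariant_prob_measure X \<mu> \<and> measure_theoretic_entropy X \<mu> = topological_entropy X"

definition intrinsically_ergodic :: "(int \<Rightarrow> 'a) set \<Rightarrow> bool" where
  "intrinsically_ergodic X \<longleftrightarrow> (\<exists>!\<mu>. measure_of_maximal_entropy X \<mu>)"

end

theory Submission
  imports Defs
begin

text \<open>
  Balancedness gives \<open>c N\<^sub>m N\<^sub>n \<le> N\<^bsub>m+n\<^esub> \<le> N\<^sub>m N\<^sub>n\<close> for the number \<open>N\<^sub>n\<close> of words of length \<open>n\<close>,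
  so every limit \<open>\<mu>\<close> of averaged uniform distributions on words satisfies the Gibbs bounds
  \<open>c\<^sup>2 \<le> N\<^sub>n \<mu>[w] \<le> 1 / c\<^sup>2\<close> and hence has maximal entropy.  Comparing a measure \<open>\<nu>\<close> of maximal
  entropy with \<open>\<mu>\<close> on a clopen set \<open>C\<close> by Gibbs' inequality bounds \<open>\<nu>(C) ln (1 / \<mu>(C))\<close> uniformly,
  whence \<open>\<nu>\<close> is absolutely continuous with respect to \<open>\<mu>\<close>.  Uniqueness then follows from ergodicity of
  \<open>\<mu>\<close>: past and future are independent up to a constant factor on the cylinder of a synchronizing word
  \<open>s\<close>, and almost every point sees \<open>s\<close>, because any word \<open>u\<close> extends to some \<open>s w u\<close>, whose
  continuations are a fixed proportion of all words and by Poincare recurrence mostly contain \<open>s\<close> again.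
\<close>

section \<open>Words, windows and the Borel structure\<close>

text \<open>Irreducibility supplies a connecting word \<open>w\<close> without any bound on its
  length, and an estimate that pays for the letters of \<open>w\<close> would degenerate as
  \<open>u\<close> varies. But the lower bound on the number of continuations is uniform in the
  preceding word, so \<open>s w u\<close> may be arbitrarily long; as every continuation of
  \<open>s w u\<close> also continues \<open>u\<close>, the unknown length drops out again.
  Balancedness alone links a word to a fixed proportion of the others and says nothing about two
  given words. This is why independence is sought only across \<open>s\<close>, where every past
  ending in \<open>s\<close> can be glued to every future starting with it. In the comparison with
  \<nu>, both entropies are limits of subadditive sequences and hence infima, so n times the entropy
  of \<nu> bounds its block entropy from below for every n, while supermultiplicativity keeps the
  logarithm of the number of words within a constant of n times the topological entropy. The linear
  terms cancel, leaving a bound free of the window length. Ergodicity meets absolute continuity in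
  the density of \<nu>, which is invariant almost everywhere; a single level set of it decides the
  matter.\<close>

lemma length_subword [simp]: "length (subword x a n) = n"
  by (simp add: subword_def)

lemma nth_subword [simp]: "k < n \<Longrightarrow> subword x a n ! k = x (a + int k)"
  by (simp add: subword_def)

lemma subword_0 [simp]: "subword x a 0 = []"
  by (simp add: subword_def)

lemma subword_eq_iff: "subword x a n = subword y b n \<longleftrightarrow> (\<forall>k<n. x (a + int k) = y (b + int k))"
  by (auto simp: list_eq_iff_nth_eq)

lemma subword_add: "subword x a (m + n) = subword x a m @ subword x (a + int m) n"
  by (rule nth_equalityI) (auto simp: nth_append algebra_simps)

lemma take_drop_subword:
  "k + m \<le> n \<Longrightarrow> take m (drop k (subword x a n)) = subword x (a + int k) m"
  by (rule nth_equalityI) (auto simp: algebra_simps)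

lemma take_subword: "m \<le> n \<Longrightarrow> take m (subword x a n) = subword x a m"
  using take_drop_subword[of 0 m n x a] by simp

text \<open>All integer powers of the shift: the ergodicity proof moves one window both to the right
  and to the left of the origin.\<close>

definition shift_by :: "int \<Rightarrow> (int \<Rightarrow> 'a) \<Rightarrow> int \<Rightarrow> 'a" where
  "shift_by j x = (\<lambda>i. x (i + j))"

lemma shift_by_simps [simp]:
  "shift_by 0 x = x" "shift_by i (shift_by j x) = shift_by (i + j) x"
  by (simp_all add: shift_by_def algebra_simps)

lemma left_shift_eq: "left_shift = shift_by 1"
  by (simp add: left_shift_def shift_by_def fun_eq_iff)

lemma subword_shift_by [simp]: "subword (shift_by j x) a n = subword x (a + j) n"
  by (auto simp: list_eq_iff_nth_eq shift_by_def algebra_simps)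

text \<open>These are the clopen subsets of \<open>X\<close>. \<open>W\<close> ranges over all sets
  of lists, so that complements and unions in \<open>X\<close> become complements and unions of
  \<open>W\<close>.\<close>

definition window :: "(int \<Rightarrow> 'a) set \<Rightarrow> int \<Rightarrow> nat \<Rightarrow> 'a list set \<Rightarrow> (int \<Rightarrow> 'a) set" where
  "window X a n W = {x \<in> X. subword x a n \<in> W}"

definition windows :: "(int \<Rightarrow> 'a) set \<Rightarrow> (int \<Rightarrow> 'a) set set" where
  "windows X = {window X a n W | a n W. True}"

lemma cylinder_eq_window: "cylinder X w a = window X a (length w) {w}"
  by (simp add: cylinder_def window_def)

lemma window_in_windows [simp]: "window X a n W \<in> windows X"
  by (auto simp: windows_def)

lemma cylinder_in_windows [simp]: "cylinder X w a \<in> windows X"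
  by (simp add: cylinder_eq_window)

lemma window_extend:
  assumes "a' \<le> a" "a + int n \<le> a' + int n'"
  shows "window X a n W = window X a' n' {v. take n (drop (nat (a - a')) v) \<in> W}"
proof -
  have "take n (drop (nat (a - a')) (subword x a' n')) = subword x a n" for x :: "int \<Rightarrow> 'a"
    using take_drop_subword[of "nat (a - a')" n n' x a'] assms by (simp add: nat_diff_distrib)
  then show ?thesis by (simp add: window_def)
qed

text \<open>The representation is available on every large symmetric block, not just on one, so that
  two windows can be read off a common block.\<close>

lemma windows_symmetricE:
  assumes "C \<in> windows X"
  obtains m where "\<And>m'. m \<le> m' \<Longrightarrow> \<exists>W. C = window X (- int m') (2 * m') W"
proof -
  obtain a n W where C: "C = window X a n W"
    using assms by (auto simp: windows_def)
  have "\<exists>W. C = window X (- int m') (2 * m') W" if "nat \<bar>a\<bar> + n \<le> m'" for m'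
    using window_extend[of "- int m'" a n "2 * m'" X W] that C by auto
  then show ?thesis using that by blast
qed

lemma windows_common:
  assumes "C \<in> windows X" "D \<in> windows X"
  obtains m V W where "C = window X (- int m) (2 * m) V" "D = window X (- int m) (2 * m) W"
proof -
  obtain m1 m2 where "\<And>m'. m1 \<le> m' \<Longrightarrow> \<exists>W. C = window X (- int m') (2 * m') W"
     "\<And>m'. m2 \<le> m' \<Longrightarrow> \<exists>W. D = window X (- int m') (2 * m') W"
    using assms by (meson windows_symmetricE)
  from this(1)[of "max m1 m2"] this(2)[of "max m1 m2"] show ?thesis
    using that[of "max m1 m2"] by auto
qed

lemma windows_top [simp]: "X \<in> windows X"
proof -
  have "X = window X 0 0 UNIV" by (simp add: window_def)
  then show ?thesis by (metis window_in_windows)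
qed

lemma algebra_windows: "algebra X (windows X)"
proof (rule algebra_iff_Un[THEN iffD2], intro conjI ballI)
  show "windows X \<subseteq> Pow X" by (auto simp: windows_def window_def)
  have "{} = window X 0 0 {}" by (simp add: window_def)
  then show "{} \<in> windows X" by (metis window_in_windows)
  show "X - C \<in> windows X" if C: "C \<in> windows X" for C
  proof -
    obtain a n W where "C = window X a n W"
      using C by (auto simp: windows_def)
    then have "X - C = window X a n (- W)" by (auto simp: window_def)
    then show ?thesis by simp
  qed
  show "C \<union> D \<in> windows X" if CD: "C \<in> windows X" "D \<in> windows X" for C D
  proof -
    obtain m V W where *: "C = window X (- int m) (2 * m) V" "D = window X (- int m) (2 * m) W"
      using windows_common[OF CD] .
    then have "C \<union> D = window X (- int m) (2 * m) (V \<union> W)" by (auto simp: window_def)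
    then show ?thesis by simp
  qed
qed

section \<open>Words of a shift space and their number\<close>

locale subshift =
  fixes X :: "(int \<Rightarrow> 'a::finite) set"
  assumes shift_space: "shift_space X"
begin

abbreviation B :: "nat \<Rightarrow> 'a list set" where "B n \<equiv> words_of_length n X"
abbreviation N :: "nat \<Rightarrow> real" where "N n \<equiv> real (card (B n))"

lemma nonempty: "X \<noteq> {}"
  using shift_space by (simp add: shift_space_def)

text \<open>The backward direction for \<open>j = 1\<close> combines surjectivity of the shift on
  \<open>X\<close> with its injectivity on all sequences; a negative \<open>j\<close> is undone by a
  positive one.\<close>

lemma shift_by_iff [simp]: "shift_by j x \<in> X \<longleftrightarrow> x \<in> X"
proof -
  have L: "shift_by 1 ` X = X"
    using shift_space by (simp add: shift_space_def left_shift_eq)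
  have 1: "shift_by 1 y \<in> X \<longleftrightarrow> y \<in> X" for y
  proof
    assume "shift_by 1 y \<in> X"
    then obtain z where z: "z \<in> X" "shift_by 1 y = shift_by 1 z" using L by blast
    have "y = z" using arg_cong[OF z(2), of "shift_by (-1)"] by simp
    then show "y \<in> X" using z(1) by simp
  qed (use L in blast)
  have 2: "shift_by (int n) y \<in> X \<longleftrightarrow> y \<in> X" for n y
  proof (induction n)
    case (Suc n)
    then show ?case using 1[of "shift_by (int n) y"] by (simp add: algebra_simps)
  qed simp
  show ?thesis
  proof (cases "j \<ge> 0")
    case True then show ?thesis using 2[of "nat j"] by simp
  next
    case False then show ?thesis using 2[of "nat (- j)" "shift_by j x"] by simp
  qed
qed

lemma B_eq: "B n = (\<lambda>x. subword x a n) ` X"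
proof -
  have "subword x i n = subword (shift_by (i - a) x) a n" for x :: "int \<Rightarrow> 'a" and i
    by simp
  then show ?thesis
    unfolding words_of_length_def using shift_by_iff by blast
qed

lemma subword_in_B [simp]: "x \<in> X \<Longrightarrow> subword x a n \<in> B n"
  by (auto simp: words_of_length_def)

lemma B_obtain:
  assumes "w \<in> B n" obtains x where "x \<in> X" "subword x a n = w"
  using assms by (subst (asm) B_eq[of n a]) auto

lemma length_B: "w \<in> B n \<Longrightarrow> length w = n"
  by (auto simp: words_of_length_def)

lemma finite_B [simp]: "finite (B n)"
proof (rule finite_subset)
  show "B n \<subseteq> {w. set w \<subseteq> UNIV \<and> length w = n}" using length_B by auto
qed (rule finite_lists_length_eq, simp)

lemma language_iff: "w \<in> language X \<longleftrightarrow> w \<in> B (length w)"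
  unfolding language_def using length_B by fastforce

lemma B_append_iff: "length u = n \<Longrightarrow> u @ v \<in> B m \<Longrightarrow> u \<in> B n \<and> v \<in> B (m - n)"
proof -
  assume n: "length u = n" and uv: "u @ v \<in> B m"
  then have m: "m = n + length v" using length_B by fastforce
  from uv obtain x where x: "x \<in> X" "subword x 0 m = u @ v" by (rule B_obtain)
  then have "subword x 0 n @ subword x (int n) (length v) = u @ v"
    using subword_add[of x 0 n "length v"] by (simp add: m)
  then have "u = subword x 0 n" "v = subword x (int n) (length v)" using n by auto
  then show ?thesis using x(1) m by (metis add_diff_cancel_left' subword_in_B)
qed

lemma language_appendD:
  assumes "u @ v \<in> language X" shows "u \<in> language X" "v \<in> language X"
  using B_append_iff[of u "length u" v "length (u @ v)"] assms by (auto simp: language_iff)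

lemma B_nonempty [simp]: "B n \<noteq> {}"
  using nonempty by (auto simp: B_eq[of n 0])

lemma card_B_pos [simp]: "0 < card (B n)"
  by (simp add: card_gt_0_iff)

lemma N_pos: "0 < N n"
  by simp

lemma N_nonzero [simp]: "N n \<noteq> 0" using N_pos[of n] by linarith

lemma N_ge_1 [simp]: "1 \<le> N n"
  using card_B_pos[of n] by linarith

lemma B_0 [simp]: "B 0 = {[]}"
  using B_eq[of 0 0] nonempty by auto

lemma N_submult: "N (m + n) \<le> N m * N n"
proof -
  have "B (m + n) \<subseteq> (\<lambda>(u, v). u @ v) ` (B m \<times> B n)"
  proof
    fix w assume "w \<in> B (m + n)"
    then obtain x where x: "x \<in> X" "subword x 0 (m + n) = w" by (rule B_obtain)
    then have "w = subword x 0 m @ subword x (int m) n" using subword_add[of x 0 m n] by simp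
    then show "w \<in> (\<lambda>(u, v). u @ v) ` (B m \<times> B n)" using x by force
  qed
  then have "card (B (m + n)) \<le> card (B m \<times> B n)"
    by (meson finite_B finite_SigmaI surj_card_le)
  then show ?thesis by (metis card_cartesian_product of_nat_le_iff of_nat_mult)
qed

lemma window_preimage: "shift_by j -` window X a n W \<inter> X = window X (a + j) n W"
  by (auto simp: window_def)

lemma windows_preimage: "C \<in> windows X \<Longrightarrow> shift_by j -` C \<inter> X \<in> windows X"
  by (auto simp: windows_def window_preimage) blast

lemma window_eq_UN: "window X a n W = (\<Union>w\<in>W \<inter> B n. cylinder X w a)"
  using length_B by (auto simp: window_def cylinder_def) 

lemma disjoint_cylinders: "disjoint_family_on (\<lambda>w. cylinder X w a) (B n)"
  using length_B by (auto simp: disjoint_family_on_def cylinder_def)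

section \<open>Windows generate the Borel sets of the compact space\<close>

lemma topspace_full [simp]: "topspace full_shift_topology = (UNIV :: (int \<Rightarrow> 'a) set)"
  by (simp add: full_shift_topology_def)

lemma window_openin: "openin (subtopology full_shift_topology X) (window X a n W)"
proof -
  have "openin full_shift_topology {x :: int \<Rightarrow> 'a. subword x a n \<in> W}"
    unfolding full_shift_topology_def openin_product_topology_alt
  proof (intro ballI)
    fix x :: "int \<Rightarrow> 'a" assume x: "x \<in> {x. subword x a n \<in> W}"
    let ?U = "\<lambda>i. if a \<le> i \<and> i < a + int n then {x i} else UNIV"
    have "finite {i \<in> UNIV. ?U i \<noteq> topspace (discrete_topology UNIV)}"
      by (rule finite_subset[of _ "{a..<a + int n}"]) auto
    moreover have "Pi\<^sub>E UNIV ?U \<subseteq> {x. subword x a n \<in> W}"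
    proof
      fix y assume y: "y \<in> Pi\<^sub>E UNIV ?U"
      have "subword y a n = subword x a n"
      proof (subst subword_eq_iff, intro allI impI)
        fix k assume "k < n"
        moreover have "y (a + int k) \<in> ?U (a + int k)" using y by (rule PiE_mem) simp
        ultimately show "y (a + int k) = x (a + int k)" by simp
      qed
      then show "y \<in> {x. subword x a n \<in> W}" using x by simp
    qed
    ultimately show "\<exists>U. finite {i \<in> UNIV. U i \<noteq> topspace (discrete_topology UNIV)} \<and>
        (\<forall>i\<in>UNIV. openin (discrete_topology UNIV) (U i)) \<and> x \<in> Pi\<^sub>E UNIV U \<and>
        Pi\<^sub>E UNIV U \<subseteq> {x. subword x a n \<in> W}"
      by (intro exI[of _ ?U]) auto
  qed
  then show ?thesis
    unfolding openin_subtopology window_def by blast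
qed

text \<open>Cutting \<open>W\<close> down to the finite set \<open>B n\<close> leaves finitely many
  windows for each position and length.\<close>

lemma countable_windows: "countable (windows X)"
proof -
  have fin: "windows X \<subseteq> (\<Union>(a, n) \<in> UNIV. window X a n ` Pow (B n))"
  proof
    fix C assume "C \<in> windows X"
    then obtain a n W where "C = window X a n W" by (auto simp: windows_def)
    then have "C = window X a n (W \<inter> B n)" by (auto simp: window_def)
    then show "C \<in> (\<Union>(a, n) \<in> UNIV. window X a n ` Pow (B n))" by blast
  qed
  have "countable (\<Union>(a, n) \<in> (UNIV :: (int \<times> nat) set). window X a n ` Pow (B n))"
    by (intro countable_UN) (auto intro!: countable_finite)
  then show ?thesis using fin countable_subset by blast
qed

lemma open_is_Union_windows:
  assumes U: "openin (subtopology full_shift_topology X) U" and x: "x \<in> U"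
  shows "\<exists>C\<in>windows X. x \<in> C \<and> C \<subseteq> U"
proof -
  obtain V where V: "openin full_shift_topology V" "U = V \<inter> X"
    using U by (auto simp: openin_subtopology)
  with x obtain R where R: "finite {i. R i \<noteq> UNIV}" "x \<in> Pi\<^sub>E UNIV R" "Pi\<^sub>E UNIV R \<subseteq> V"
    unfolding full_shift_topology_def openin_product_topology_alt by auto
  \<comment> \<open>A basic open set constrains finitely many coordinates; \<open>m\<close> is
    chosen so that all of them lie strictly between \<open>- m\<close> and \<open>m\<close>, whence
    fixing the central block of \<open>x\<close> stays inside the set.\<close>
  obtain m :: nat where m: "\<And>i. R i \<noteq> UNIV \<Longrightarrow> \<bar>i\<bar> < int m"
  proof -
    have "finite ((\<lambda>i. nat \<bar>i\<bar>) ` {i. R i \<noteq> UNIV})" using R by simp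
    then obtain m where "\<And>j. j \<in> (\<lambda>i. nat \<bar>i\<bar>) ` {i. R i \<noteq> UNIV} \<Longrightarrow> j < m"
      by (meson finite_nat_set_iff_bounded)
    then show ?thesis using that[of m] by force
  qed
  let ?C = "window X (- int m) (2 * m) {subword x (- int m) (2 * m)}"
  have "y \<in> Pi\<^sub>E UNIV R" if "y \<in> ?C" for y
  proof (rule PiE_I)
    fix i
    show "y i \<in> R i"
    proof (cases "R i = UNIV")
      case False
      then have i: "\<bar>i\<bar> < int m" using m by blast
      have "\<forall>k<2*m. y (- int m + int k) = x (- int m + int k)"
        using that by (simp add: window_def subword_eq_iff)
      moreover have "nat (i + int m) < 2 * m" "- int m + int (nat (i + int m)) = i" using i by auto
      ultimately have "y i = x i" by metis
      then show ?thesis using R(2) PiE_mem[of x UNIV R i] by simp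
    qed simp
  qed simp
  moreover have "x \<in> ?C" "?C \<subseteq> X" using x V by (auto simp: window_def)
  ultimately show ?thesis using R(3) V(2) by (intro bexI[of _ ?C]) (blast, simp)
qed

text \<open>An open set is the union of the windows inside it, and countability of
  \<open>windows X\<close> makes this a countable union.\<close>

lemma sets_shift_borel: "sets (shift_borel X) = sigma_sets X (windows X)"
proof -
  let ?O = "{U. openin (subtopology full_shift_topology X) U}"
  have O: "?O \<subseteq> Pow X" using openin_subset by fastforce
  have "sigma_sets X ?O = sigma_sets X (windows X)"
  proof (rule sigma_sets_eqI)
    fix U assume U: "U \<in> ?O"
    have "U = \<Union> {C \<in> windows X. C \<subseteq> U}"
      using open_is_Union_windows[of U] U by blast
    moreover have "countable {C \<in> windows X. C \<subseteq> U}"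
      using countable_windows by (rule countable_subset[rotated]) auto
    moreover have "\<Union> {C \<in> windows X. C \<subseteq> U} \<in> sigma_sets X (windows X)"
      by (rule sigma_sets_UNION[OF \<open>countable _\<close>]) (auto intro: sigma_sets.Basic)
    ultimately show "U \<in> sigma_sets X (windows X)" by simp
  next
    fix C assume "C \<in> windows X"
    then show "C \<in> sigma_sets X ?O"
      by (auto simp: windows_def window_openin intro: sigma_sets.Basic)
  qed
  then show ?thesis using O by (simp add: shift_borel_def)
qed

lemma space_shift_borel [simp]: "space (shift_borel X) = X"
  unfolding shift_borel_def by (rule space_measure_of) (use openin_subset in fastforce)

text \<open>Nested nonempty closed sets in a compact space have a common point. This supplies the
  continuity at the empty set that turns a finitely additive function on windows into a
  measure.\<close>

lemma windows_compact:
  assumes C: "range C \<subseteq> windows X" "decseq C" "(\<Inter>i. C i) = {}"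
  obtains i where "C i = {}"
proof (rule ccontr)
  assume "\<not> thesis"
  then have ne: "C n \<noteq> {}" for n using that by blast
  have "compact_space (full_shift_topology :: (int \<Rightarrow> 'a) topology)"
    by (simp add: full_shift_topology_def compact_space_product_topology compact_space_discrete_topology)
  moreover have "closedin full_shift_topology X"
    using shift_space by (simp add: shift_space_def)
  ultimately have cpt: "compact_space (subtopology full_shift_topology X)"
    by (simp add: closedin_compact_space compact_space_subtopology)
  have "closedin (subtopology full_shift_topology X) (C n)" for n
  proof -
    interpret algebra X "windows X" by (rule algebra_windows)
    have "X - C n \<in> windows X" "C n \<subseteq> X" using C(1) sets_into_space by auto
    then show ?thesis
      by (auto simp: closedin_def windows_def window_openin)
  qed
  from compact_space_imp_nest[OF cpt this ne C(2)] C(3) show False by simp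
qed

end

section \<open>Entropy\<close>

text \<open>Fekete's lemma: the limit is the infimum of \<open>a n / n\<close>. The second
  conclusion records the infimum, since later estimates need a lower bound at each single
  \<open>n\<close>.\<close>

lemma fekete:
  fixes a :: "nat \<Rightarrow> real"
  assumes sub: "\<And>m n. a (m + n) \<le> a m + a n" and nn: "\<And>n. 0 \<le> a n"
  obtains L where "(\<lambda>n. a n / real n) \<longlonglongrightarrow> L" "\<And>n. real n * L \<le> a n"
proof -
  let ?S = "(\<lambda>n. a n / real n) ` {1..}"
  define L where "L = Inf ?S"
  have bdd: "bdd_below ?S" by (rule bdd_belowI2[of _ 0]) (simp add: nn)
  have L: "L \<le> a n / real n" if "n \<ge> 1" for n
    unfolding L_def by (rule cInf_lower[OF _ bdd]) (use that in auto)
  have mult: "a (q * k + r) \<le> real q * a k + a r" for q k r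
  proof (induction q)
    case (Suc q)
    have "a (Suc q * k + r) \<le> a k + a (q * k + r)"
      using sub[of k "q * k + r"] by (simp add: algebra_simps)
    then show ?case using Suc by (simp add: algebra_simps)
  qed simp
  have "(\<lambda>n. a n / real n) \<longlonglongrightarrow> L"
  proof (rule order_tendstoI)
    fix b assume "b < L"
    then have "\<forall>n\<ge>1. b < a n / real n" using L by fastforce
    then show "\<forall>\<^sub>F n in sequentially. b < a n / real n"
      unfolding eventually_sequentially by blast
  next
    fix b assume "L < b"
    then obtain k where k: "k \<ge> 1" "a k / real k < b"
      unfolding L_def using cInf_lessD[of ?S b] by auto
    \<comment> \<open>A bound for all remainders \<open>a r\<close> with \<open>r < k\<close>, where
      n is divided by \<open>k\<close> with remainder; its share \<open>M / n\<close> vanishes in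
      the limit.\<close>
    define M where "M = (\<Sum>r<k. a r)"
    have M: "a r \<le> M" if "r < k" for r
      unfolding M_def by (rule member_le_sum) (use that nn in auto)
    have le: "a n / real n \<le> a k / real k + M / real n" if n: "n \<ge> 1" for n
    proof -
      have "a n \<le> real (n div k) * a k + a (n mod k)" using mult[of "n div k" k "n mod k"] by simp
      also have "\<dots> \<le> (real n / real k) * a k + M"
        by (intro add_mono mult_right_mono M nn of_nat_div_le_of_nat) (use k in auto)
      finally have "a n / real n \<le> ((real n / real k) * a k + M) / real n"
        by (rule divide_right_mono) simp
      also have "\<dots> = a k / real k + M / real n" using n k by (simp add: field_simps)
      finally show ?thesis .
    qed
    have "(\<lambda>n. a k / real k + M / real n) \<longlonglongrightarrow> a k / real k + 0"
      by (intro tendsto_intros lim_const_over_n)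
    then have "\<forall>\<^sub>F n in sequentially. a k / real k + M / real n < b"
      using order_tendstoD(2) k(2) by force
    then show "\<forall>\<^sub>F n in sequentially. a n / real n < b"
      using eventually_ge_at_top[of 1] by eventually_elim (use le in force)
  qed
  moreover have "real n * L \<le> a n" for n
    using L[of n] nn[of 0] by (cases "n = 0") (auto simp: field_simps)
  ultimately show ?thesis using that by blast
qed

text \<open>Termwise \<open>ln t \<le> t - 1\<close> at \<open>t = q x / p x\<close>. The hypothesis
  \<open>pos\<close> excludes points where the right side ought to be infinite but the convention
  \<open>ln 0 = 0\<close> would make it vanish.\<close>

lemma gibbs_inequality:
  fixes p q :: "'b \<Rightarrow> real"
  assumes "\<And>x. x \<in> A \<Longrightarrow> 0 \<le> p x" "\<And>x. x \<in> A \<Longrightarrow> 0 \<le> q x"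
    and pos: "\<And>x. x \<in> A \<Longrightarrow> 0 < p x \<Longrightarrow> 0 < q x" and "sum q A \<le> sum p A"
  shows "- (\<Sum>x\<in>A. p x * ln (p x)) \<le> - (\<Sum>x\<in>A. p x * ln (q x))"
proof -
  have "p x * ln (q x) - p x * ln (p x) \<le> q x - p x" if x: "x \<in> A" for x
  proof (cases "p x = 0")
    case False
    then have px: "0 < p x" "0 < q x" using assms x by (auto simp: order_less_le)
    have "p x * ln (q x / p x) \<le> p x * (q x / p x - 1)"
      using ln_le_minus_one[of "q x / p x"] px by (intro mult_left_mono) auto
    then show ?thesis using px by (simp add: ln_div right_diff_distrib)
  qed (use assms x in simp)
  then have "(\<Sum>x\<in>A. p x * ln (q x) - p x * ln (p x)) \<le> (\<Sum>x\<in>A. q x - p x)"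
    by (rule sum_mono)
  then show ?thesis using assms(4) by (simp add: sum_subtractf)
qed

lemma (in subshift) topological_entropy:
  "(\<lambda>n. ln (N n) / real n) \<longlonglongrightarrow> topological_entropy X" "real n * topological_entropy X \<le> ln (N n)"
proof -
  have "ln (N (m + n)) \<le> ln (N m) + ln (N n)" for m n
    using N_submult[of m n] by (metis N_nonzero N_pos ln_le_cancel_iff ln_mult mult_pos_pos)
  moreover have "0 \<le> ln (N n)" for n using N_ge_1[of n] ln_ge_zero by blast
  ultimately obtain L where L: "(\<lambda>n. ln (N n) / real n) \<longlonglongrightarrow> L" "\<And>n. real n * L \<le> ln (N n)"
    using fekete[of "\<lambda>n. ln (N n)"] by blast
  have "topological_entropy X = L"
    unfolding topological_entropy_def using limI[OF L(1)] by (simp add: field_simps)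
  then show "(\<lambda>n. ln (N n) / real n) \<longlonglongrightarrow> topological_entropy X"
    "real n * topological_entropy X \<le> ln (N n)" using L by auto
qed

lemma (in subshift) take_drop_B:
  assumes "w \<in> B (m + n)" shows "take m w \<in> B m" "drop m w \<in> B n"
  using B_append_iff[of "take m w" m "drop m w" "m + n"] assms length_B[OF assms] by auto

section \<open>Block entropies of an invariant measure\<close>

locale shift_measure = subshift X for X :: "(int \<Rightarrow> 'a::finite) set" +
  fixes M :: "(int \<Rightarrow> 'a) measure"
  assumes invariant: "invariant_prob_measure X M"
begin

sublocale prob_space M
  using invariant by (simp add: invariant_prob_measure_def)

lemma sets_M: "sets M = sigma_sets X (windows X)"
  using invariant by (simp add: invariant_prob_measure_def sets_shift_borel)

lemma space_M [simp]: "space M = X"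
proof -
  have "sets M = sets (shift_borel X)" using invariant by (simp add: invariant_prob_measure_def)
  then show ?thesis using sets_eq_imp_space_eq[of M "shift_borel X"] by simp
qed

lemma windows_sets [simp]: "C \<in> windows X \<Longrightarrow> C \<in> sets M"
  by (simp add: sets_M sigma_sets.Basic)

lemma measurable_shift_by [measurable]: "shift_by j \<in> measurable M M"
proof (rule measurable_sigma_sets[OF sets_M])
  show "windows X \<subseteq> Pow X" by (auto simp: windows_def window_def)
qed (use windows_preimage in auto)

lemma emeasure_shift_by:
  assumes "E \<in> sets M" shows "emeasure M (shift_by j -` E \<inter> X) = emeasure M E"
proof -
  have meas [simp]: "shift_by i -` E \<inter> X \<in> sets M" if "E \<in> sets M" for E i
    using measurable_sets[OF measurable_shift_by that] by simp
  have 1: "emeasure M (shift_by 1 -` E \<inter> X) = emeasure M E" if "E \<in> sets M" for E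
    using that invariant by (simp add: invariant_prob_measure_def left_shift_eq)
  have 2: "emeasure M (shift_by (int n) -` E \<inter> X) = emeasure M E" if E: "E \<in> sets M" for E n
  proof (induction n)
    case 0
    have "shift_by 0 -` E \<inter> X = E" using sets.sets_into_space[OF E] by auto
    then show ?case by (metis of_nat_0)
  next
    case (Suc n)
    have "shift_by (int (Suc n)) -` E \<inter> X = shift_by 1 -` (shift_by (int n) -` E \<inter> X) \<inter> X"
      by (auto simp: algebra_simps)
    then show ?case using Suc 1[OF meas[OF E]] by simp
  qed
  show ?thesis
  proof (cases "j \<ge> 0")
    case True then show ?thesis using 2[OF assms, of "nat j"] by simp
  next
    case False
    have "shift_by (int (nat (- j))) -` (shift_by j -` E \<inter> X) \<inter> X = E"
      using False sets.sets_into_space[OF assms] by auto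
    then show ?thesis using 2[OF meas[OF assms], of "nat (- j)" j] by simp
  qed
qed

lemma prob_shift_by: "E \<in> sets M \<Longrightarrow> prob (shift_by j -` E \<inter> X) = prob E"
  by (simp add: measure_def emeasure_shift_by)

lemma prob_window_shift: "prob (window X a n W) = prob (window X 0 n W)"
  using prob_shift_by[of "window X 0 n W" a] by (simp add: window_preimage)

lemma prob_cylinder_shift: "prob (cylinder X w a) = prob (cylinder X w 0)"
  unfolding cylinder_eq_window by (rule prob_window_shift)

abbreviation P :: "'a list \<Rightarrow> real" where "P w \<equiv> prob (cylinder X w 0)"

lemma prob_window: "prob (window X a n W) = (\<Sum>w\<in>W \<inter> B n. P w)"
proof -
  have "prob (window X a n W) = (\<Sum>w\<in>W \<inter> B n. prob (cylinder X w a))"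
    unfolding window_eq_UN
    by (rule finite_measure_finite_Union)
      (auto intro: disjoint_family_on_mono[OF _ disjoint_cylinders])
  then show ?thesis by (simp add: prob_cylinder_shift[of _ a])
qed

lemma sum_P: "sum P (B n) = 1"
  using prob_window[of 0 n UNIV] prob_space by (simp add: window_def)

lemma sum_P_prefix:
  assumes "u \<in> B m" shows "(\<Sum>w | w \<in> B (m + n) \<and> take m w = u. P w) = P u"
proof -
  have "cylinder X u 0 = window X 0 m {u}" using assms by (simp add: cylinder_eq_window length_B)
  also have "\<dots> = window X 0 (m + n) {w. take m w = u}" by (subst window_extend[of 0 0 m "m + n"]) auto
  finally show ?thesis using prob_window[of 0 "m + n" "{w. take m w = u}"]
    by (simp add: Int_def conj_commute)
qed

text \<open>Unlike the sum over prefixes, this uses invariance: the cylinder of \<open>v\<close> at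
  coordinate \<open>m\<close> is as large as the one at 0.\<close>

lemma sum_P_suffix:
  assumes "v \<in> B n" shows "(\<Sum>w | w \<in> B (m + n) \<and> drop m w = v. P w) = P v"
proof -
  have "cylinder X v (int m) = window X (int m) n {v}"
    using assms by (simp add: cylinder_eq_window length_B)
  also have "\<dots> = window X 0 (m + n) {w. take n (drop m w) = v}"
    by (subst window_extend[of 0 "int m" n "m + n"]) auto
  finally have "P v = (\<Sum>w | w \<in> B (m + n) \<and> take n (drop m w) = v. P w)"
    using prob_window[of 0 "m + n" "{w. take n (drop m w) = v}"] prob_cylinder_shift[of v "int m"]
    by (simp add: Int_def conj_commute)
  also have "{w. w \<in> B (m + n) \<and> take n (drop m w) = v} = {w. w \<in> B (m + n) \<and> drop m w = v}"
    by (auto dest: length_B)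
  finally show ?thesis by simp
qed

text \<open>The Shannon entropy of a block of length \<open>n\<close>.\<close>

definition H :: "nat \<Rightarrow> real" where
  "H n = - (\<Sum>w\<in>B n. P w * ln (P w))"

lemma H_nonneg: "0 \<le> H n"
proof -
  have "P w * ln (P w) \<le> 0" for w
    by (cases "P w = 0") (auto intro!: mult_nonneg_nonpos simp: zero_less_measure_iff)
  then show ?thesis unfolding H_def by (simp add: sum_nonpos)
qed

text \<open>Gibbs' inequality against the product of the distributions of the first \<open>m\<close>
  and the last \<open>n\<close> letters; summing over the words with a given prefix or suffix
  recovers the two block entropies.\<close>

lemma H_subadditive: "H (m + n) \<le> H m + H n"
proof -
  have fib_take: "(\<Sum>w\<in>B (m + n). P w * g (take m w)) = (\<Sum>u\<in>B m. P u * g u)" for g :: "_ \<Rightarrow> real"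
  proof -
    have "(\<Sum>w\<in>B (m + n). P w * g (take m w)) =
        (\<Sum>u\<in>B m. \<Sum>w | w \<in> B (m + n) \<and> take m w = u. P w * g (take m w))"
      by (rule sum.group[symmetric]) (use take_drop_B in auto)
    also have "\<dots> = (\<Sum>u\<in>B m. (\<Sum>w | w \<in> B (m + n) \<and> take m w = u. P w) * g u)"
      by (simp add: sum_distrib_right)
    finally show ?thesis by (simp add: sum_P_prefix)
  qed
  have fib_drop: "(\<Sum>w\<in>B (m + n). P w * g (drop m w)) = (\<Sum>u\<in>B n. P u * g u)" for g :: "_ \<Rightarrow> real"
  proof -
    have "(\<Sum>w\<in>B (m + n). P w * g (drop m w)) =
        (\<Sum>u\<in>B n. \<Sum>w | w \<in> B (m + n) \<and> drop m w = u. P w * g (drop m w))"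
      by (rule sum.group[symmetric]) (use take_drop_B in auto)
    also have "\<dots> = (\<Sum>u\<in>B n. (\<Sum>w | w \<in> B (m + n) \<and> drop m w = u. P w) * g u)"
      by (simp add: sum_distrib_right)
    finally show ?thesis by (simp add: sum_P_suffix)
  qed
  have pos: "0 < P (take m w)" "0 < P (drop m w)" if w: "w \<in> B (m + n)" "0 < P w" for w
  proof -
    have "P w \<le> (\<Sum>w' | w' \<in> B (m + n) \<and> take m w' = take m w. P w')"
      by (rule member_le_sum) (use w in auto)
    then show "0 < P (take m w)" using sum_P_prefix[of "take m w" m n] take_drop_B w by auto
    have "P w \<le> (\<Sum>w' | w' \<in> B (m + n) \<and> drop m w' = drop m w. P w')"
      by (rule member_le_sum) (use w in auto)
    then show "0 < P (drop m w)" using sum_P_suffix[of "drop m w" n m] take_drop_B w by auto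
  qed
  \<comment> \<open>The product weights have total at most 1 on \<open>B (m + n)\<close>, because a
    word is determined by its two halves and these range over part of
    \<open>B m \<times> B n\<close> only.\<close>
  have "(\<Sum>w\<in>B (m + n). P (take m w) * P (drop m w)) =
      (\<Sum>(u, v)\<in>(\<lambda>w. (take m w, drop m w)) ` B (m + n). P u * P v)"
    by (subst sum.reindex) (auto intro!: inj_onI, metis append_take_drop_id)
  also have "\<dots> \<le> (\<Sum>(u, v)\<in>B m \<times> B n. P u * P v)"
    by (rule sum_mono2) (use take_drop_B in auto)
  also have "\<dots> = sum P (B m) * sum P (B n)" by (simp add: sum_product sum.cartesian_product)
  finally have "H (m + n) \<le> - (\<Sum>w\<in>B (m + n). P w * ln (P (take m w) * P (drop m w)))"
    unfolding H_def by (intro gibbs_inequality) (use pos in \<open>auto simp: sum_P\<close>)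
  also have "(\<Sum>w\<in>B (m + n). P w * ln (P (take m w) * P (drop m w))) =
      (\<Sum>w\<in>B (m + n). P w * ln (P (take m w)) + P w * ln (P (drop m w)))"
  proof (rule sum.cong[OF refl])
    fix w assume w: "w \<in> B (m + n)"
    show "P w * ln (P (take m w) * P (drop m w)) = P w * ln (P (take m w)) + P w * ln (P (drop m w))"
    proof (cases "P w = 0")
      case False
      then have "0 < P w" by (simp add: zero_less_measure_iff)
      then show ?thesis using pos[OF w] by (simp add: ln_mult algebra_simps)
    qed simp
  qed
  finally show ?thesis
    using fib_take[of "\<lambda>u. ln (P u)"] fib_drop[of "\<lambda>u. ln (P u)"] by (simp add: sum.distrib H_def)
qed

lemma measure_theoretic_entropy:
  "(\<lambda>n. H n / real n) \<longlonglongrightarrow> measure_theoretic_entropy X M" "real n * measure_theoretic_entropy X M \<le> H n"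
proof -
  obtain L where L: "(\<lambda>n. H n / real n) \<longlonglongrightarrow> L" "\<And>n. real n * L \<le> H n"
    using fekete[of H] H_subadditive H_nonneg by blast
  have "(\<lambda>n. 1 / real n * (\<Sum>w\<in>B n. P w * ln (P w))) \<longlonglongrightarrow> - L"
    using tendsto_minus[OF L(1)] by (simp add: H_def)
  then have "measure_theoretic_entropy X M = L"
    unfolding measure_theoretic_entropy_def by (simp add: limI)
  then show "(\<lambda>n. H n / real n) \<longlonglongrightarrow> measure_theoretic_entropy X M"
    "real n * measure_theoretic_entropy X M \<le> H n" using L by auto
qed

end

section \<open>Balanced shifts and Gibbs measures\<close>

text \<open>One constant serves both sides. Having \<open>c \<le> 1\<close> makes the bounds hold
  for \<open>n = 0\<close> as well and gives \<open>ln c\<close> the sign used in the entropy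
  estimate.\<close>

locale balanced_shift = subshift X for X :: "(int \<Rightarrow> 'a::finite) set" +
  fixes c :: real
  assumes c_pos: "0 < c" and c_le_1: "c \<le> 1"
    and followers: "u \<in> language X \<Longrightarrow> c * N n \<le> real (card {v \<in> B n. u @ v \<in> language X})"
    and predecessors: "u \<in> language X \<Longrightarrow> c * N n \<le> real (card {v \<in> B n. v @ u \<in> language X})"
begin

section \<open>Counting words with a prescribed middle part\<close>

lemma subword_middle_le:
  assumes "i + k \<le> n"
  shows "real (card {w \<in> B n. take k (drop i w) = u}) \<le> N i * N (n - i - k)"
proof -
  have inj: "inj_on (\<lambda>w. (take i w, drop (i + k) w)) {w \<in> B n. take k (drop i w) = u}"
  proof (rule inj_onI)
    fix v w
    assume v: "v \<in> {w \<in> B n. take k (drop i w) = u}" and w: "w \<in> {w \<in> B n. take k (drop i w) = u}"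
      and eq: "(take i v, drop (i + k) v) = (take i w, drop (i + k) w)"
    have split: "x = take i x @ take k (drop i x) @ drop (i + k) x" for x :: "'a list"
      by (metis append_take_drop_id drop_drop add.commute)
    show "v = w" using split[of v] split[of w] v w eq by simp
  qed
  have "(\<lambda>w. (take i w, drop (i + k) w)) ` {w \<in> B n. take k (drop i w) = u} \<subseteq> B i \<times> B (n - i - k)"
    using take_drop_B[of _ i "n - i"] take_drop_B[of _ "i + k" "n - i - k"] assms by auto
  then have "card {w \<in> B n. take k (drop i w) = u} \<le> card (B i \<times> B (n - i - k))"
    by (rule card_inj_on_le[OF inj]) simp
  then show ?thesis by (metis card_cartesian_product of_nat_le_iff of_nat_mult)
qed

text \<open>One factor \<open>c\<close> comes from choosing \<open>v\<close> before
  \<open>u\<close>, the other from choosing \<open>z\<close> after \<open>v @ u\<close>; the second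
  choice relies on the follower bound being uniform over words of any length.\<close>

lemma subword_middle_ge:
  assumes "i + k \<le> n" and u: "u \<in> B k"
  shows "c\<^sup>2 * N i * N (n - i - k) \<le> real (card {w \<in> B n. take k (drop i w) = u})"
proof -
  let ?V = "{v \<in> B i. v @ u \<in> language X}"
  let ?Z = "\<lambda>v. {z \<in> B (n - i - k). (v @ u) @ z \<in> language X}"
  have ul: "u \<in> language X" "length u = k" using u length_B by (auto simp: language_iff)
  have "(c * N i) * (c * N (n - i - k)) \<le> real (card ?V) * (c * N (n - i - k))"
    by (intro mult_right_mono predecessors ul) (use c_pos in simp)
  also have "\<dots> = (\<Sum>v\<in>?V. c * N (n - i - k))" by simp
  also have "\<dots> \<le> (\<Sum>v\<in>?V. real (card (?Z v)))" by (intro sum_mono followers) auto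
  also have "\<dots> = real (card (Sigma ?V ?Z))" by (subst card_SigmaI) auto
  also have "card (Sigma ?V ?Z) \<le> card {w \<in> B n. take k (drop i w) = u}"
  proof (rule card_inj_on_le)
    show "inj_on (\<lambda>(v, z). v @ u @ z) (Sigma ?V ?Z)"
    proof (rule inj_onI, clarify)
      fix v z v' z' assume "v \<in> B i" "v' \<in> B i" "v @ u @ z = v' @ u @ z'"
      then show "v = v' \<and> z = z'" using length_B[of v i] length_B[of v' i] by simp
    qed
    show "(\<lambda>(v, z). v @ u @ z) ` Sigma ?V ?Z \<subseteq> {w \<in> B n. take k (drop i w) = u}"
    proof clarify
      fix v z assume v: "v \<in> B i" and z: "z \<in> B (n - i - k)" and l: "(v @ u) @ z \<in> language X"
      have len: "length v = i" "length z = n - i - k" using v z length_B by auto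
      then have "length ((v @ u) @ z) = n" using ul assms(1) by simp
      then show "v @ u @ z \<in> B n \<and> take k (drop i (v @ u @ z)) = u"
        using l ul len by (metis append_eq_conv_conj append.assoc language_iff)
    qed
  qed simp
  finally show ?thesis by (simp add: power2_eq_square algebra_simps)
qed

lemma N_supermult: "c * N m * N n \<le> N (m + n)"
proof -
  have "c * N m * N n = (\<Sum>u\<in>B m. c * N n)" by simp
  also have "\<dots> \<le> (\<Sum>u\<in>B m. real (card {v \<in> B n. u @ v \<in> language X}))"
    by (intro sum_mono followers) (auto simp: language_iff length_B)
  also have "\<dots> = real (card (SIGMA u:B m. {v \<in> B n. u @ v \<in> language X}))"
    by (subst card_SigmaI) auto
  also have "card (SIGMA u:B m. {v \<in> B n. u @ v \<in> language X}) \<le> card (B (m + n))"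
  proof (rule card_inj_on_le)
    show "inj_on (\<lambda>(u, v). u @ v) (SIGMA u:B m. {v \<in> B n. u @ v \<in> language X})"
    proof (rule inj_onI, clarify)
      fix u v u' v' assume "u \<in> B m" "u' \<in> B m" "u @ v = u' @ v'"
      then show "u = u' \<and> v = v'" using length_B[of u m] length_B[of u' m] by simp
    qed
    show "(\<lambda>(u, v). u @ v) ` (SIGMA u:B m. {v \<in> B n. u @ v \<in> language X}) \<subseteq> B (m + n)"
      using length_B by (fastforce simp: language_iff)
  qed simp
  finally show ?thesis by simp
qed

lemma N_power: "c ^ m * N n ^ m \<le> N (m * n)"
proof (induction m)
  case (Suc m)
  have "c ^ Suc m * N n ^ Suc m = c * N n * (c ^ m * N n ^ m)" by (simp add: algebra_simps)
  also have "\<dots> \<le> c * N n * N (m * n)" using Suc c_pos by (intro mult_left_mono) auto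
  also have "\<dots> \<le> N (n + m * n)" by (rule N_supermult)
  finally show ?case by (simp add: add.commute)
qed simp

text \<open>Iterated supermultiplicativity bounds \<open>(ln c + ln (N n)) / n\<close> by the
  entropy quotient at \<open>m * n\<close>, and \<open>m\<close> tends to infinity. With the lower
  bound from Fekete's lemma, \<open>N n\<close> is exponential up to a constant factor.\<close>

lemma ln_N_le: "ln (N n) \<le> real n * topological_entropy X - ln c"
proof (cases "n = 0")
  case True
  then show ?thesis using c_pos c_le_1 by simp
next
  case n: False
  have "(\<lambda>m. ln (N (m * n)) / real (m * n)) \<longlonglongrightarrow> topological_entropy X"
    using n by (intro filterlim_compose[OF topological_entropy(1)] mult_nat_right_at_top) auto
  moreover have "\<forall>\<^sub>F m in sequentially. (ln c + ln (N n)) / real n \<le> ln (N (m * n)) / real (m * n)"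
    using eventually_ge_at_top[of 1]
  proof eventually_elim
    case (elim m)
    have "ln ((c * N n) ^ m) \<le> ln (N (m * n))"
      using N_power[of m n] c_pos by (subst ln_le_cancel_iff) (auto simp: power_mult_distrib)
    then have "real m * (ln c + ln (N n)) \<le> ln (N (m * n))"
      using c_pos by (simp add: ln_realpow ln_mult)
    then have "real m * (ln c + ln (N n)) / real (m * n) \<le> ln (N (m * n)) / real (m * n)"
      by (rule divide_right_mono) simp
    then show ?case using elim by simp
  qed
  ultimately have "(ln c + ln (N n)) / real n \<le> topological_entropy X"
    by (rule tendsto_lowerbound) simp
  then show ?thesis using n by (simp add: field_simps)
qed

section \<open>Empirical averages and their limit\<close>

definition point_with :: "nat \<Rightarrow> 'a list \<Rightarrow> int \<Rightarrow> 'a" where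
  "point_with n w = (SOME x. x \<in> X \<and> subword x 0 n = w)"

lemma point_with:
  assumes "w \<in> B n" shows "point_with n w \<in> X" "subword (point_with n w) 0 n = w"
proof -
  have "\<exists>x. x \<in> X \<and> subword x 0 n = w" using assms by (metis B_obtain)
  from someI_ex[OF this] show "point_with n w \<in> X" "subword (point_with n w) 0 n = w"
    by (simp_all add: point_with_def)
qed

text \<open>Orbits of length \<open>n\<close> are averaged over words of length \<open>2n\<close>, so that a subword of length
  at most \<open>n\<close> read along the orbit is always a subword of the chosen word.\<close>

definition empirical :: "nat \<Rightarrow> (int \<Rightarrow> 'a) set \<Rightarrow> real" where
  "empirical n C =
     (\<Sum>w\<in>B (2 * n). \<Sum>i<n. indicator C (shift_by (int i) (point_with (2 * n) w))) / (real n * N (2 * n))"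

lemma empirical_Un: "C \<inter> D = {} \<Longrightarrow> empirical n (C \<union> D) = empirical n C + empirical n D"
proof -
  assume "C \<inter> D = {}"
  then have "indicator (C \<union> D) y = (indicator C y + indicator D y :: real)" for y
    by (auto simp: indicator_def)
  then show ?thesis by (simp add: empirical_def sum.distrib add_divide_distrib)
qed

lemma empirical_X: "1 \<le> n \<Longrightarrow> empirical n X = 1"
  by (simp add: empirical_def indicator_def point_with)

lemma empirical_nonneg: "0 \<le> empirical n C"
  by (auto simp: empirical_def intro!: divide_nonneg_nonneg sum_nonneg mult_nonneg_nonneg)

lemma empirical_le_1: "empirical n C \<le> 1"
proof -
  have "(\<Sum>w\<in>B (2 * n). \<Sum>i<n. indicator C (shift_by (int i) (point_with (2 * n) w)))
      \<le> (\<Sum>w\<in>B (2 * n). \<Sum>i<n. 1 :: real)"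
    by (intro sum_mono) (simp add: indicator_le_1)
  then have "(\<Sum>w\<in>B (2 * n). \<Sum>i<n. indicator C (shift_by (int i) (point_with (2 * n) w)))
      \<le> real n * N (2 * n)" by (simp add: mult.commute)
  then show ?thesis unfolding empirical_def by (simp add: divide_le_eq zero_less_mult_iff)
qed

text \<open>Along each orbit segment the two sums telescope to a difference of end terms, at most 1
  in absolute value, against the normalisation by \<open>n\<close>.\<close>

lemma empirical_shift: "\<bar>empirical n (shift_by 1 -` C \<inter> X) - empirical n C\<bar> \<le> 1 / real n"
proof (cases "n = 0")
  case n: False
  let ?f = "\<lambda>w i. indicator C (shift_by (int i) (point_with (2 * n) w)) :: real"
  have "(\<Sum>i<n. indicator (shift_by 1 -` C \<inter> X) (shift_by (int i) (point_with (2 * n) w))) -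
      (\<Sum>i<n. ?f w i) = ?f w n - ?f w 0" if w: "w \<in> B (2 * n)" for w
  proof -
    have "indicator (shift_by 1 -` C \<inter> X) (shift_by (int i) (point_with (2 * n) w)) = ?f w (Suc i)" for i
      using point_with[OF w] by (simp add: indicator_def add.commute)
    then show ?thesis
      by (simp only: sum_lessThan_telescope[of "?f w"] flip: sum_subtractf)
  qed
  then have "empirical n (shift_by 1 -` C \<inter> X) - empirical n C =
      (\<Sum>w\<in>B (2 * n). ?f w n - ?f w 0) / (real n * N (2 * n))"
    by (simp add: empirical_def flip: diff_divide_distrib sum_subtractf cong: sum.cong)
  moreover have "\<bar>\<Sum>w\<in>B (2 * n). ?f w n - ?f w 0\<bar> \<le> (\<Sum>w\<in>B (2 * n). 1)"
    by (intro order_trans[OF sum_abs] sum_mono) (auto simp: indicator_def)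
  ultimately have "\<bar>empirical n (shift_by 1 -` C \<inter> X) - empirical n C\<bar> \<le>
      N (2 * n) / (real n * N (2 * n))"
    by (simp only: abs_divide abs_mult abs_of_nat) (rule divide_right_mono, auto)
  then show ?thesis by simp
qed (simp add: empirical_def)

text \<open>\<open>D i\<close> counts the words showing \<open>u\<close> at position
  \<open>i\<close>. It is compared with \<open>N (2 * n) / N k\<close> for each \<open>i\<close>
  separately, with constants independent of \<open>i\<close>, so averaging preserves the
  bounds.\<close>

lemma empirical_cylinder:
  assumes u: "u \<in> B k" and n: "k \<le> n" "1 \<le> n"
  shows "c\<^sup>2 / N k \<le> empirical n (cylinder X u 0)" "empirical n (cylinder X u 0) \<le> 1 / (c\<^sup>2 * N k)"
proof -
  define D where "D i = card {w \<in> B (2 * n). take k (drop i w) = u}" for i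
  have "indicator (cylinder X u 0) (shift_by (int i) (point_with (2 * n) w)) =
      (of_bool (take k (drop i w) = u) :: real)" if w: "w \<in> B (2 * n)" and i: "i < n" for w i
  proof -
    have "subword (point_with (2 * n) w) (int i) k = take k (drop i w)"
      using take_drop_subword[of i k "2 * n" "point_with (2 * n) w" 0] point_with[OF w] n i by simp
    then show ?thesis using length_B[OF u] point_with[OF w] by (simp add: cylinder_def indicator_def)
  qed
  then have "(\<Sum>w\<in>B (2 * n). \<Sum>i<n. indicator (cylinder X u 0) (shift_by (int i) (point_with (2 * n) w)))
      = (\<Sum>i<n. \<Sum>w\<in>B (2 * n). of_bool (take k (drop i w) = u) :: real)"
    by (subst sum.swap) (intro sum.cong, auto)
  also have "\<dots> = (\<Sum>i<n. real (D i))"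
    by (simp add: D_def Int_def of_bool_def sum.If_cases conj_commute)
  finally have eq: "empirical n (cylinder X u 0) = (\<Sum>i<n. real (D i)) / (real n * N (2 * n))"
    by (simp add: empirical_def)
  \<comment> \<open>The factor \<open>c\<^sup>2\<close> stems from the count of words with middle
    \<open>u\<close>; submultiplicativity then replaces the outer factors at no further
    cost.\<close>
  have lo: "c\<^sup>2 * N (2 * n) / N k \<le> real (D i)" if i: "i < n" for i
  proof -
    have "N (2 * n) \<le> N i * N k * N (2 * n - i - k)"
    proof -
      have "N (2 * n) \<le> N (i + k) * N (2 * n - i - k)"
        using N_submult[of "i + k" "2 * n - i - k"] n i by simp
      also have "\<dots> \<le> N i * N k * N (2 * n - i - k)" by (intro mult_right_mono N_submult) simp
      finally show ?thesis .
    qed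
    then have "c\<^sup>2 * N (2 * n) \<le> N k * (c\<^sup>2 * N i * N (2 * n - i - k))"
      using c_pos by (simp add: algebra_simps)
    also have "\<dots> \<le> N k * real (D i)"
      unfolding D_def by (intro mult_left_mono subword_middle_ge u) (use n i in auto)
    finally show ?thesis by (simp add: field_simps)
  qed
  \<comment> \<open>Here the count costs nothing, and joining the three blocks by
    supermultiplicativity costs \<open>c\<close> twice.\<close>
  have hi: "real (D i) \<le> N (2 * n) / (c\<^sup>2 * N k)" if i: "i < n" for i
  proof -
    have "c\<^sup>2 * N k * real (D i) \<le> c\<^sup>2 * N k * (N i * N (2 * n - i - k))"
      unfolding D_def using n i c_pos by (intro mult_left_mono subword_middle_le) auto
    also have "\<dots> = c * (c * N i * N k) * N (2 * n - i - k)"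
      by (simp add: power2_eq_square algebra_simps)
    also have "\<dots> \<le> c * N (i + k) * N (2 * n - i - k)"
      using c_pos by (intro mult_right_mono mult_left_mono N_supermult) auto
    also have "\<dots> \<le> N (i + k + (2 * n - i - k))" by (rule N_supermult)
    finally show ?thesis using n i c_pos by (simp add: field_simps)
  qed
  have "real n * (c\<^sup>2 * N (2 * n) / N k) \<le> (\<Sum>i<n. real (D i))"
    using sum_mono[of "{..<n}" "\<lambda>_. c\<^sup>2 * N (2 * n) / N k" "\<lambda>i. real (D i)"] lo by simp
  then show "c\<^sup>2 / N k \<le> empirical n (cylinder X u 0)"
    using n by (simp add: eq field_simps)
  have "(\<Sum>i<n. real (D i)) \<le> real n * (N (2 * n) / (c\<^sup>2 * N k))"
    using sum_mono[of "{..<n}" "\<lambda>i. real (D i)" "\<lambda>_. N (2 * n) / (c\<^sup>2 * N k)"] hi by simp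
  then have "(\<Sum>i<n. real (D i)) / (real n * N (2 * n)) \<le> real n * (N (2 * n) / (c\<^sup>2 * N k)) / (real n * N (2 * n))"
    by (rule divide_right_mono) simp
  then show "empirical n (cylinder X u 0) \<le> 1 / (c\<^sup>2 * N k)"
    using n by (simp add: eq field_simps)
qed

end

text \<open>Tychonoff's theorem for a power of the unit interval. The index type may be uncountable,
  where convergent subsequences can fail to exist; hence a filter finer than
  \<open>sequentially\<close> takes their place.\<close>

lemma bounded_functions_cluster:
  fixes g :: "nat \<Rightarrow> 'b \<Rightarrow> real"
  assumes "\<And>n C. g n C \<in> {0..1}"
  obtains G f where "G \<noteq> bot" "G \<le> sequentially" "\<And>C. ((\<lambda>n. g n C) \<longlongrightarrow> f C) G"
proof -
  have "compactin (product_topology (\<lambda>_. euclideanreal) UNIV) (Pi\<^sub>E UNIV (\<lambda>_ :: 'b. {0..1}))"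
    by (simp add: compactin_PiE)
  then have "compact (Pi\<^sub>E UNIV (\<lambda>_ :: 'b. {0..1 :: real}))"
    by (simp add: euclidean_product_topology)
  moreover have "filtermap g sequentially \<noteq> bot" by (simp add: filtermap_bot_iff)
  moreover have "\<forall>\<^sub>F y in filtermap g sequentially. y \<in> Pi\<^sub>E UNIV (\<lambda>_. {0..1})"
    unfolding eventually_filtermap by (intro always_eventually allI PiE_I) (use assms in auto)
  ultimately obtain f where f: "inf (nhds f) (filtermap g sequentially) \<noteq> bot"
    unfolding compact_filter by blast
  \<comment> \<open>The pullback of the neighbourhoods of \<open>f\<close>, restricted to large
    indices; it is proper exactly because \<open>f\<close> is a cluster point of the
    sequence.\<close>
  define G where "G = inf (filtercomap g (nhds f)) sequentially"
  have "G \<noteq> bot"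
  proof
    assume "G = bot"
    then have "eventually (\<lambda>_. False) G" by simp
    then obtain P Q where P: "eventually P (filtercomap g (nhds f))"
      and Q: "eventually Q sequentially" and PQ: "\<And>n. P n \<Longrightarrow> Q n \<Longrightarrow> False"
      unfolding G_def eventually_inf by blast
    obtain P' where P': "eventually P' (nhds f)" "\<And>n. P' (g n) \<Longrightarrow> P n"
      using P unfolding eventually_filtercomap by blast
    have "eventually (\<lambda>y. \<exists>n. Q n \<and> y = g n) (filtermap g sequentially)"
      unfolding eventually_filtermap using Q by (rule eventually_mono) auto
    then have "eventually (\<lambda>_. False) (inf (nhds f) (filtermap g sequentially))"
      unfolding eventually_inf using P' PQ by blast
    then show False using f by (simp add: trivial_limit_def)
  qed
  moreover have "G \<le> sequentially" by (simp add: G_def)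
  moreover have "((\<lambda>n. g n C) \<longlongrightarrow> f C) G" for C
  proof -
    have "filterlim g (nhds f) G"
      unfolding G_def by (rule filterlim_mono[OF filterlim_filtercomap]) auto
    moreover have "((\<lambda>h. h C) \<longlongrightarrow> f C) (nhds f)"
    proof (rule topological_tendstoI)
      fix S :: "real set" assume "open S" "f C \<in> S"
      moreover have "continuous_on UNIV (\<lambda>h :: 'b \<Rightarrow> real. h C)" by simp
      ultimately have "open ((\<lambda>h. h C) -` S)" "f \<in> (\<lambda>h. h C) -` S"
        by (auto intro: open_vimage)
      then show "\<forall>\<^sub>F h in nhds f. h C \<in> S" unfolding eventually_nhds by blast
    qed
    ultimately show ?thesis using filterlim_compose by fastforce
  qed
  ultimately show ?thesis by (rule that)
qed

locale gibbs_measure = balanced_shift X c + shift_measure X M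
  for X :: "(int \<Rightarrow> 'a::finite) set" and c M +
  assumes gibbs_ge: "u \<in> B k \<Longrightarrow> c\<^sup>2 / N k \<le> P u"
    and gibbs_le: "u \<in> B k \<Longrightarrow> P u \<le> 1 / (c\<^sup>2 * N k)"

text \<open>The limit \<open>f\<close> is finitely additive on all sets. On windows, compactness
  makes it continuous at the empty set, so Caratheodory's theorem extends that restriction to a
  measure, which inherits the uniform cylinder bounds.\<close>

theorem (in balanced_shift) gibbs_measure_exists: "\<exists>M. gibbs_measure X c M"
proof -
  have "empirical n C \<in> {0..1}" for n C
    using empirical_nonneg empirical_le_1 by simp
  then obtain G f where G: "G \<noteq> bot" "G \<le> sequentially"
    and f: "\<And>C. ((\<lambda>n. empirical n C) \<longlongrightarrow> f C) G"
    using bounded_functions_cluster[of empirical] by blast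
  have ev: "eventually Q G" if "\<And>n. k \<le> n \<Longrightarrow> Q n" for Q k
    using that G(2) by (meson eventually_sequentially filter_leD)
  have f_X: "f X = 1"
    by (rule tendsto_unique[OF G(1) f tendsto_eventually]) (rule ev, rule empirical_X)
  have f_Un: "f (C \<union> D) = f C + f D" if "C \<inter> D = {}" for C D
  proof (rule tendsto_unique[OF G(1) f])
    show "((\<lambda>n. empirical n (C \<union> D)) \<longlongrightarrow> f C + f D) G"
      unfolding empirical_Un[OF that] by (intro tendsto_add f)
  qed
  have f_nonneg: "0 \<le> f C" for C
    by (rule tendsto_lowerbound[OF f _ G(1)]) (simp add: empirical_nonneg)
  have f_empty: "f {} = 0" using f_Un[of "{}" "{}"] by simp
  have f_shift: "f (shift_by 1 -` C \<inter> X) = f C" for C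
  proof -
    have "((\<lambda>n. empirical n (shift_by 1 -` C \<inter> X) - empirical n C) \<longlongrightarrow> 0) G"
    proof (rule Lim_null_comparison)
      show "((\<lambda>n. 1 / real n) \<longlongrightarrow> 0) G"
        using lim_const_over_n[of 1] G(2) by (rule tendsto_mono[rotated])
    qed (simp add: empirical_shift)
    moreover have "((\<lambda>n. empirical n (shift_by 1 -` C \<inter> X) - empirical n C) \<longlongrightarrow> f (shift_by 1 -` C \<inter> X) - f C) G"
      by (intro tendsto_diff f)
    ultimately show ?thesis using tendsto_unique[OF G(1)] by fastforce
  qed
  \<comment> \<open>\<open>Suc k\<close> secures both \<open>k \<le> n\<close> and
    \<open>1 \<le> n\<close> in the empirical bounds.\<close>
  have f_ge: "c\<^sup>2 / N k \<le> f (cylinder X u 0)" if "u \<in> B k" for u k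
    by (rule tendsto_lowerbound[OF f _ G(1)], rule ev[of "Suc k"])
      (rule empirical_cylinder[OF that], auto)
  have f_le: "f (cylinder X u 0) \<le> 1 / (c\<^sup>2 * N k)" if "u \<in> B k" for u k
    by (rule tendsto_upperbound[OF f _ G(1)], rule ev[of "Suc k"])
      (rule empirical_cylinder[OF that], auto)
  interpret A: algebra X "windows X" by (rule algebra_windows)
  obtain \<mu> :: "(int \<Rightarrow> 'a) set \<Rightarrow> ennreal" where \<mu>: "\<And>C. C \<in> windows X \<Longrightarrow> \<mu> C = ennreal (f C)"
    "measure_space X (sigma_sets X (windows X)) \<mu>"
  proof -
    have "\<exists>\<mu> :: (int \<Rightarrow> 'a) set \<Rightarrow> ennreal. (\<forall>C\<in>windows X. \<mu> C = ennreal (f C)) \<and>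
        measure_space X (sigma_sets X (windows X)) \<mu>"
    proof (rule A.caratheodory_empty_continuous)
      show "positive (windows X) (\<lambda>C. ennreal (f C))" by (simp add: positive_def f_empty)
      show "additive (windows X) (\<lambda>C. ennreal (f C))"
        by (simp add: additive_def f_Un f_nonneg ennreal_plus)
    next
      fix A :: "nat \<Rightarrow> (int \<Rightarrow> 'a) set"
      assume A: "range A \<subseteq> windows X" "decseq A" "(\<Inter>i. A i) = {}"
      obtain i where "A i = {}" using windows_compact[OF A] .
      then have "A j = {}" if "i \<le> j" for j using decseqD[OF A(2) that] by auto
      then have "\<forall>\<^sub>F j in sequentially. ennreal (f (A j)) = 0"
        unfolding eventually_sequentially by (metis f_empty ennreal_0)
      then show "(\<lambda>j. ennreal (f (A j))) \<longlonglongrightarrow> 0" by (rule tendsto_eventually)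
    qed simp
    then show ?thesis using that by blast
  qed
  define M where "M = measure_of X (sigma_sets X (windows X)) \<mu>"
  have sa: "sigma_algebra X (sigma_sets X (windows X))"
    using \<mu>(2) by (simp add: measure_space_def)
  then have sets: "sets M = sigma_sets X (windows X)"
    by (simp add: M_def sigma_algebra.sets_measure_of_eq)
  then have space: "space M = X"
    by (metis sets_shift_borel sets_eq_imp_space_eq space_shift_borel)
  have em: "emeasure M E = \<mu> E" if "E \<in> sets M" for E
    unfolding M_def by (rule emeasure_measure_of_sigma[OF sa])
      (use \<mu>(2) that sets in \<open>auto simp: measure_space_def\<close>)
  have emw: "emeasure M C = ennreal (f C)" if "C \<in> windows X" for C
    using em[of C] that \<mu>(1) sets by (simp add: sigma_sets.Basic)
  have meas: "shift_by 1 \<in> measurable M M"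
    by (rule measurable_sigma_sets[OF sets A.space_closed])
      (use windows_preimage space in \<open>auto simp: sets\<close>)
  \<comment> \<open>Invariance is known on windows only; since these are closed under intersection
    and generate the Borel sets, it passes to all of them.\<close>
  have "distr M M (shift_by 1) = M"
  proof (rule measure_eqI_generator_eq[OF A.Int_stable A.space_closed])
    fix C assume C: "C \<in> windows X"
    then have "emeasure (distr M M (shift_by 1)) C = emeasure M (shift_by 1 -` C \<inter> X)"
      using meas space sets by (simp add: emeasure_distr sigma_sets.Basic)
    then show "emeasure (distr M M (shift_by 1)) C = emeasure M C"
      using C by (simp add: emw windows_preimage f_shift)
  next
    show "range (\<lambda>_ :: nat. X) \<subseteq> windows X" by auto
    show "emeasure (distr M M (shift_by 1)) X \<noteq> \<infinity>"
      using meas space sets by (simp add: emeasure_distr sigma_sets.Basic emw vimage_def)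
  qed (use sets in auto)
  then have inv: "emeasure M (left_shift -` E \<inter> X) = emeasure M E" if "E \<in> sets M" for E
    using emeasure_distr[OF meas that] by (simp add: space left_shift_eq)
  have "prob_space M" by (rule prob_spaceI) (simp add: space emw f_X)
  with inv interpret shift_measure X M
    by unfold_locales (simp add: invariant_prob_measure_def sets sets_shift_borel)
  have "P u = f (cylinder X u 0)" for u by (simp add: measure_def emw f_nonneg)
  then have "gibbs_measure X c M" by unfold_locales (use f_ge f_le in auto)
  then show ?thesis ..
qed

context gibbs_measure
begin

lemma P_pos: "u \<in> B k \<Longrightarrow> 0 < P u"
  using gibbs_ge[of u k] c_pos by (smt (verit) N_pos divide_pos_pos zero_less_power)

text \<open>The Gibbs bounds put each \<open>- ln (P w)\<close> within \<open>K\<close> of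
  \<open>ln (N n)\<close>, hence also their mean \<open>H n\<close>; after division by
  \<open>n\<close> the two entropies agree in the limit.\<close>

lemma max_entropy: "measure_of_maximal_entropy X M"
proof -
  define K where "K = - ln (c\<^sup>2)"
  have bd: "\<bar>H n - ln (N n)\<bar> \<le> K" for n
  proof -
    have ln_bd: "\<bar>- ln (P w) - ln (N n)\<bar> \<le> K" if w: "w \<in> B n" for w
    proof -
      have "ln (c\<^sup>2 / N n) \<le> ln (P w)" "ln (P w) \<le> ln (1 / (c\<^sup>2 * N n))"
        using gibbs_ge[OF w] gibbs_le[OF w] P_pos[OF w] c_pos by auto
      then show ?thesis using c_pos by (simp add: K_def ln_div ln_mult abs_le_iff)
    qed
    have "H n - ln (N n) = (\<Sum>w\<in>B n. P w * (- ln (P w) - ln (N n)))"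
      by (simp add: H_def algebra_simps sum_subtractf sum_negf flip: sum_distrib_left sum_distrib_right) 
        (simp add: sum_P)
    also have "\<bar>\<dots>\<bar> \<le> (\<Sum>w\<in>B n. P w * K)"
      using ln_bd by (intro order_trans[OF sum_abs] sum_mono) (auto simp: abs_mult intro!: mult_left_mono)
    finally show ?thesis by (simp add: sum_P flip: sum_distrib_right)
  qed
  have "(\<lambda>n. H n / real n - ln (N n) / real n) \<longlonglongrightarrow> 0"
  proof (rule Lim_null_comparison)
    show "\<forall>\<^sub>F n in sequentially. norm (H n / real n - ln (N n) / real n) \<le> K / real n"
      using bd by (auto simp: divide_right_mono abs_divide simp flip: diff_divide_distrib)
    show "(\<lambda>n. K / real n) \<longlonglongrightarrow> 0" by (rule lim_const_over_n)
  qed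
  moreover have "(\<lambda>n. H n / real n - ln (N n) / real n) \<longlonglongrightarrow>
      measure_theoretic_entropy X M - topological_entropy X"
    by (intro tendsto_diff measure_theoretic_entropy topological_entropy)
  ultimately have "measure_theoretic_entropy X M - topological_entropy X = 0"
    using LIMSEQ_unique by blast
  then show ?thesis using invariant by (simp add: measure_of_maximal_entropy_def)
qed

end

section \<open>Measures of maximal entropy are absolutely continuous\<close>

text \<open>The same \<open>C\<close> has to serve both measures, so the induction over the
  generated sigma-algebra runs on their sum \<open>S\<close>. A countable union is cut off where the
  remainder \<open>R n\<close> is small.\<close>

lemma approx_by_algebra:
  fixes M M' :: "'b measure"
  assumes A: "algebra \<Omega> A" and M: "finite_measure M" "sets M = sigma_sets \<Omega> A"
    and M': "finite_measure M'" "sets M' = sigma_sets \<Omega> A"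
    and E: "E \<in> sigma_sets \<Omega> A" and e: "0 < e"
  shows "\<exists>C\<in>A. measure M (sym_diff E C) + measure M' (sym_diff E C) < e"
proof -
  interpret A: algebra \<Omega> A by (rule A)
  interpret M: finite_measure M by (rule M)
  interpret M': finite_measure M' by (rule M')
  define S where "S E = measure M E + measure M' E" for E
  have mono: "S C \<le> S D" if "C \<subseteq> D" "D \<in> sets M" for C D
    unfolding S_def using that M M' by (intro add_mono M.finite_measure_mono M'.finite_measure_mono) auto
  have S_Un: "S (C \<union> D) \<le> S C + S D" if "C \<in> sets M" "D \<in> sets M" for C D
    using measure_Un_le[of C M D] measure_Un_le[of C M' D] that M M'
    by (simp add: S_def)
  have S_UN: "S (\<Union>i<n. C i) \<le> (\<Sum>i<n. S (C i))" if "\<And>i. C i \<in> sets M" for C and n :: nat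
    using M.finite_measure_subadditive_finite[of "{..<n}" C]
      M'.finite_measure_subadditive_finite[of "{..<n}" C] that M M'
    by (fastforce simp: S_def sum.distrib image_subset_iff)
  have "\<exists>C\<in>A. S (sym_diff E C) < e" if "0 < e" for e
    using E that
  proof (induction arbitrary: e rule: sigma_sets.induct)
    case (Basic a)
    then show ?case by (intro bexI[of _ a]) (auto simp: S_def)
  next
    case Empty
    then show ?case by (intro bexI[of _ "{}"]) (auto simp: S_def)
  next
    case (Compl a)
    then obtain C where C: "C \<in> A" "S (sym_diff a C) < e" by blast
    have "a \<subseteq> \<Omega>" "C \<subseteq> \<Omega>"
      using sigma_sets_into_sp[OF A.space_closed Compl.hyps] A.sets_into_space[OF C(1)] by auto
    then have "sym_diff (\<Omega> - a) (\<Omega> - C) = sym_diff a C" by auto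
    then show ?case using C by (intro bexI[of _ "\<Omega> - C"]) auto
  next
    case (Union a)
    define U where "U = (\<Union>i. a i)"
    have a [simp]: "a i \<in> sets M" for i using Union.hyps M by simp
    have U [simp]: "U \<in> sets M" unfolding U_def by (intro sets.countable_UN) auto
    define R where "R n = U - (\<Union>i<n. a i)" for n
    have R [simp]: "R n \<in> sets M" for n unfolding R_def by (intro sets.Diff sets.finite_UN) auto
    have "decseq R" unfolding R_def by (rule decseq_SucI) auto
    moreover have "(\<Inter>n. R n) = {}" by (auto simp: R_def U_def)
    ultimately have "(\<lambda>n. measure M (R n)) \<longlonglongrightarrow> measure M {}" "(\<lambda>n. measure M' (R n)) \<longlonglongrightarrow> measure M' {}"
      using M.finite_Lim_measure_decseq[of R] M'.finite_Lim_measure_decseq[of R] R M M' by auto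
    from tendsto_add[OF this] have "(\<lambda>n. S (R n)) \<longlonglongrightarrow> 0" by (simp add: S_def)
    then have "\<forall>\<^sub>F n in sequentially. S (R n) < e / 2"
      using Union.prems by (intro order_tendstoD) auto
    then obtain n where n: "S (R n) < e / 2" by (auto simp: eventually_sequentially)
    \<comment> \<open>The errors of \<open>n\<close> sets add up to at most \<open>e / 2\<close>;
      \<open>n + 1\<close> in the denominator keeps it positive for \<open>n = 0\<close>.\<close>
    have "\<forall>i. \<exists>C\<in>A. S (sym_diff (a i) C) < e / (2 * (real n + 1))"
      using Union by simp
    then obtain C where C: "\<And>i. C i \<in> A" "\<And>i. S (sym_diff (a i) (C i)) < e / (2 * (real n + 1))"
      by metis
    have C' [simp]: "C i \<in> sets M" for i using C(1) M by (simp add: sigma_sets.Basic)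
    have D [simp]: "(\<Union>i<n. sym_diff (a i) (C i)) \<in> sets M"
      by (intro sets.finite_UN sets.Un sets.Diff finite_lessThan a C')
    have "S (sym_diff U (\<Union>i<n. C i)) \<le> S (R n \<union> (\<Union>i<n. sym_diff (a i) (C i)))"
      by (rule mono[OF _ sets.Un[OF R D]]) (force simp: R_def U_def)
    also have "\<dots> \<le> S (R n) + S (\<Union>i<n. sym_diff (a i) (C i))" by (rule S_Un) auto
    also have "S (\<Union>i<n. sym_diff (a i) (C i)) \<le> (\<Sum>i<n. S (sym_diff (a i) (C i)))"
      by (intro S_UN sets.Un sets.Diff a C')
    also have "\<dots> \<le> (\<Sum>i<n. e / (2 * (real n + 1)))" using C(2) by (intro sum_mono less_imp_le)
    also have "\<dots> \<le> e / 2" using Union.prems by (simp add: field_simps)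
    finally have "S (sym_diff U (\<Union>i<n. C i)) < e" using n by simp
    moreover have "(\<Union>i<n. C i) \<in> A" using C(1) by (intro A.finite_UN) auto
    ultimately show ?case unfolding U_def by blast
  qed
  then show ?thesis using e by (simp add: S_def)
qed

context shift_measure
begin

lemma prob_le_add:
  "A \<subseteq> E \<union> F \<Longrightarrow> E \<in> sets M \<Longrightarrow> F \<in> sets M \<Longrightarrow> prob A \<le> prob E + prob F"
  by (rule order_trans[OF finite_measure_mono measure_Un_le]) auto

lemma approx_by_window:
  assumes "E \<in> sets M" "0 < e"
  shows "\<exists>C\<in>windows X. prob (sym_diff E C) < e"
  using approx_by_algebra[OF algebra_windows finite_measure_axioms sets_M finite_measure_axioms sets_M, of E e]
    assms sets_M by (smt (verit) measure_nonneg)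

end

context gibbs_measure
begin

lemma prob_window_ge: "c\<^sup>2 / N n * real (card (W \<inter> B n)) \<le> prob (window X a n W)"
  using sum_mono[of "W \<inter> B n" "\<lambda>_. c\<^sup>2 / N n" P] gibbs_ge by (simp add: prob_window mult.commute)

lemma prob_window_le: "prob (window X a n W) \<le> real (card (W \<inter> B n)) / (c\<^sup>2 * N n)"
  using sum_mono[of "W \<inter> B n" P "\<lambda>_. 1 / (c\<^sup>2 * N n)"] gibbs_le by (simp add: prob_window)

text \<open>Gibbs' inequality is applied with the test weights \<open>1 / (2 * card V)\<close> on the words of \<open>C\<close> and
  \<open>1 / (2 * N n)\<close> on all others.\<close>

lemma max_entropy_window_bound:
  assumes \<nu>: "measure_of_maximal_entropy X \<nu>" and C: "C \<in> windows X" "0 < prob C"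
  shows "- measure \<nu> C * ln (prob C) \<le> ln 2 - 3 * ln c"
proof -
  interpret \<nu>: shift_measure X \<nu>
    using \<nu> by unfold_locales (simp add: measure_of_maximal_entropy_def)
  let ?h = "topological_entropy X"
  obtain a n W where CW: "C = window X a n W" using C by (auto simp: windows_def)
  define V where "V = W \<inter> B n"
  have CV: "C = window X a n V" by (auto simp: CW V_def window_def)
  have V: "V \<subseteq> B n" "finite V" by (auto simp: V_def)
  have "V \<noteq> {}" using C(2) by (auto simp: CV window_def)
  then have cV: "0 < card V" using V by (simp add: card_gt_0_iff)
  have \<nu>V: "measure \<nu> C = sum \<nu>.P V" using V by (simp add: CV \<nu>.prob_window Int_absorb2)
  \<comment> \<open>The lower Gibbs bound limits the number of words in a set of given measure,
    which is where \<open>prob C\<close> enters.\<close>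
  have V_le: "ln (real (card V)) \<le> ln (prob C) + ln (N n) - 2 * ln c"
  proof -
    have "real (card V) \<le> prob C * N n / c\<^sup>2"
      using prob_window_ge[of n V a] V c_pos by (simp add: CV Int_absorb2 field_simps)
    then have "ln (real (card V)) \<le> ln (prob C * N n / c\<^sup>2)"
      using cV C c_pos by (subst ln_le_cancel_iff) auto
    then show ?thesis using C c_pos by (simp add: ln_div ln_mult ln_realpow)
  qed
  define q where "q w = (if w \<in> V then 1 / (2 * real (card V)) else 1 / (2 * N n))" for w
  have BV: "B n = V \<union> (B n - V)" "V \<inter> (B n - V) = {}" using V by auto
  have split: "(\<Sum>w\<in>B n. f w) = (\<Sum>w\<in>V. f w) + (\<Sum>w\<in>B n - V. f w)" for f :: "_ \<Rightarrow> real"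
    using V by (subst BV(1), subst sum.union_disjoint) auto
  have "sum q (B n) \<le> 1"
  proof -
    have "sum q V = 1 / 2" using cV by (simp add: q_def)
    moreover have "sum q (B n - V) = real (card (B n - V)) / (2 * N n)" by (simp add: q_def)
    moreover have "real (card (B n - V)) / (2 * N n) \<le> 1 / 2"
      by (simp add: divide_le_eq card_mono)
    ultimately show ?thesis using split[of q] by linarith
  qed
  then have "\<nu>.H n \<le> - (\<Sum>w\<in>B n. \<nu>.P w * ln (q w))"
    unfolding \<nu>.H_def using cV by (intro gibbs_inequality) (auto simp: q_def \<nu>.sum_P)
  also have "\<dots> = measure \<nu> C * ln (2 * real (card V)) + (1 - measure \<nu> C) * ln (2 * N n)"
  proof -
    have "(\<Sum>w\<in>V. \<nu>.P w * ln (q w)) = measure \<nu> C * - ln (2 * real (card V))"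
      using cV unfolding \<nu>V sum_distrib_right by (intro sum.cong) (auto simp: q_def ln_div)
    moreover have "(\<Sum>w\<in>B n - V. \<nu>.P w * ln (q w)) = sum \<nu>.P (B n - V) * - ln (2 * N n)"
      unfolding sum_distrib_right by (intro sum.cong) (auto simp: q_def ln_div)
    moreover have "sum \<nu>.P (B n - V) = 1 - measure \<nu> C"
      using split[of \<nu>.P] by (simp add: \<nu>.sum_P \<nu>V)
    ultimately show ?thesis by (simp add: split algebra_simps)
  qed
  also have "\<dots> = ln 2 + measure \<nu> C * ln (real (card V)) + (1 - measure \<nu> C) * ln (N n)"
    using cV by (simp add: ln_mult algebra_simps)
  also have "\<dots> \<le> ln 2 + measure \<nu> C * (ln (prob C) + ln (N n) - 2 * ln c) + (1 - measure \<nu> C) * ln (N n)"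
    using V_le by (intro add_mono mult_left_mono) auto
  also have "\<dots> = ln 2 + measure \<nu> C * ln (prob C) + ln (N n) - measure \<nu> C * (2 * ln c)"
    by (simp add: algebra_simps)
  \<comment> \<open>Two of the three \<open>ln c\<close> come from the count of \<open>V\<close>,
    its weight \<open>measure \<nu> C\<close> being raised to 1 as \<open>ln c \<le> 0\<close>; the
    third comes from \<open>ln_N_le\<close>.\<close>
  also have "\<dots> \<le> ln 2 + measure \<nu> C * ln (prob C) + (real n * ?h - ln c) - 2 * ln c"
  proof -
    have "2 * ln c \<le> measure \<nu> C * (2 * ln c)"
      using mult_right_mono_neg[of "measure \<nu> C" 1 "2 * ln c"] c_pos c_le_1 by simp
    then show ?thesis using ln_N_le[of n] by linarith
  qed
  finally have "\<nu>.H n \<le> ln 2 + measure \<nu> C * ln (prob C) + (real n * ?h - ln c) - 2 * ln c" .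
  \<comment> \<open>Maximality of the entropy of \<nu> is used here, at the one length
    \<open>n\<close> of the window; the terms linear in \<open>n\<close> now cancel.\<close>
  moreover have "real n * ?h \<le> \<nu>.H n"
    using \<nu>.measure_theoretic_entropy(2)[of n] \<nu> by (simp add: measure_of_maximal_entropy_def)
  ultimately show ?thesis by linarith
qed

text \<open>The lower Gibbs bound gives every word positive measure, so the logarithmic bound
  applies to every nonempty window.\<close>

lemma window_null: "C \<in> windows X \<Longrightarrow> prob C = 0 \<Longrightarrow> C = {}"
proof -
  assume C: "C \<in> windows X" "prob C = 0"
  obtain a n W where CW: "C = window X a n W" using C by (auto simp: windows_def)
  have "c\<^sup>2 / N n * real (card (W \<inter> B n)) \<le> 0" using prob_window_ge[of n W a] C CW by simp
  then have "W \<inter> B n = {}" using c_pos by (auto simp: mult_le_0_iff divide_le_0_iff)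
  then show ?thesis by (auto simp: CW window_def)
qed

text \<open>A null set of positive \<nu>-measure would be approximated by windows of arbitrarily
  small measure whose \<nu>-measure stays above a fixed number, against the uniform logarithmic
  bound.\<close>

lemma max_entropy_absolutely_continuous:
  assumes \<nu>: "measure_of_maximal_entropy X \<nu>"
  shows "absolutely_continuous M \<nu>"
  unfolding absolutely_continuous_def
proof
  interpret \<nu>: shift_measure X \<nu>
    using \<nu> by unfold_locales (simp add: measure_of_maximal_entropy_def)
  fix E assume "E \<in> null_sets M"
  then have E: "E \<in> sets M" "prob E = 0" "E \<in> sets \<nu>"
    by (auto simp: measure_def sets_M \<nu>.sets_M)
  have "\<nu>.prob E = 0"
  proof (rule ccontr)
    define d where "d = \<nu>.prob E"
    assume "\<nu>.prob E \<noteq> 0"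
    then have d: "0 < d" by (simp add: d_def zero_less_measure_iff)
    define K :: real where "K = ln 2 - 3 * ln c"
    have K: "0 \<le> K" 
    proof -
      have "ln c \<le> 0" "0 \<le> ln (2 :: real)" using c_pos c_le_1 by auto
      then show ?thesis unfolding K_def by linarith
    qed
    \<comment> \<open>The first term leaves \<nu>-measure above \<open>d / 2\<close> in
      \<open>C\<close>; the second forces \<open>- ln (prob C)\<close> above
      \<open>2 * K / d + 1\<close>, whose product with \<open>d / 2\<close> exceeds \<open>K\<close>
      by \<open>d / 2\<close>.\<close>
    define e where "e = min (d / 2) (exp (- (2 * K / d + 1)))"
    have e: "0 < e" using d by (simp add: e_def)
    obtain C where C: "C \<in> windows X" "prob (sym_diff E C) + \<nu>.prob (sym_diff E C) < e"
      using approx_by_algebra[OF algebra_windows finite_measure_axioms sets_M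
          \<nu>.finite_measure_axioms \<nu>.sets_M _ e, of E] E sets_M by auto
    have Cs: "C \<in> sets M" "C \<in> sets \<nu>" using C by simp_all
    have "prob C \<le> prob E + prob (sym_diff E C)"
      by (intro prob_le_add sets.Un sets.Diff E Cs) auto
    then have C_lt: "prob C < e" using C(2) E(2) measure_nonneg[of \<nu> "sym_diff E C"] by linarith
    have "\<nu>.prob E \<le> \<nu>.prob C + \<nu>.prob (sym_diff E C)"
      by (intro \<nu>.prob_le_add sets.Un sets.Diff E Cs) auto
    moreover have "\<nu>.prob (sym_diff E C) < d / 2"
      using C(2) measure_nonneg[of M "sym_diff E C"] unfolding e_def by linarith
    ultimately have \<nu>C: "d / 2 < \<nu>.prob C" by (simp add: d_def)
    then have "C \<noteq> {}" using d by auto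
    then have C_pos: "0 < prob C" using window_null C by (auto simp: zero_less_measure_iff)
    have "ln (prob C) \<le> ln e" using C_lt C_pos by simp
    also have "ln e \<le> - (2 * K / d + 1)"
    proof -
      have "ln e \<le> ln (exp (- (2 * K / d + 1)))" using e by (subst ln_le_cancel_iff) (auto simp: e_def)
      then show ?thesis by simp
    qed
    finally have "2 * K / d + 1 \<le> - ln (prob C)" by simp
    then have "d / 2 * (2 * K / d + 1) \<le> \<nu>.prob C * (- ln (prob C))"
      using \<nu>C d K by (intro mult_mono) auto
    also have "\<dots> \<le> K" using max_entropy_window_bound[OF \<nu> C(1) C_pos] by (simp add: K_def)
    finally have "d / 2 * (2 * K / d + 1) \<le> K" .
    moreover have "d / 2 * (2 * K / d + 1) = K + d / 2" using d by (simp add: field_simps)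
    ultimately show False using d by linarith
  qed
  then show "E \<in> null_sets \<nu>" using E \<nu>.emeasure_eq_measure by auto
qed

end

section \<open>Ergodicity of the Gibbs measure\<close>

locale synchronized_gibbs_measure = gibbs_measure X c M
  for X :: "(int \<Rightarrow> 'a::finite) set" and c M +
  fixes s :: "'a list"
  assumes irreducible: "irreducible_shift X"
    and synchronizing: "synchronizing_word X s"
begin

abbreviation l :: nat where "l \<equiv> length s"

text \<open>A word ending in \<open>s\<close> and one beginning with \<open>s\<close> can always be
  glued along that \<open>s\<close>, and the result determines both. The joint window thus contains
  a word for each pair, and the Gibbs bounds turn counts into measures.\<close>

lemma prob_sync_product:
  assumes V: "V \<subseteq> B (m + l)" "\<And>v. v \<in> V \<Longrightarrow> drop m v = s"
    and W: "W \<subseteq> B (l + m)" "\<And>w. w \<in> W \<Longrightarrow> take l w = s"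
  shows "c ^ 7 * prob (window X (- int m) (m + l) V) * prob (window X 0 (l + m) W)
    \<le> prob (window X (- int m) (m + l) V \<inter> window X 0 (l + m) W)"
proof -
  define Y where "Y = {y. take (m + l) y \<in> V \<and> drop m y \<in> W}"
  have drop: "drop m (subword x (- int m) (m + l + m)) = subword x 0 (l + m)" for x :: "int \<Rightarrow> 'a"
    using subword_add[of x "- int m" m "l + m"] by (simp add: add.assoc)
  have take: "take (m + l) (subword x (- int m) (m + l + m)) = subword x (- int m) (m + l)"
    for x :: "int \<Rightarrow> 'a" by (simp add: take_subword)
  have "window X (- int m) (m + l) V \<inter> window X 0 (l + m) W = window X (- int m) (m + l + m) Y"
    unfolding window_def Y_def mem_Collect_eq drop take by blast
  moreover have "card (V \<times> W) \<le> card (Y \<inter> B (m + l + m))"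
  proof (rule card_inj_on_le)
    show "inj_on (\<lambda>(v, w). v @ drop l w) (V \<times> W)"
    proof (rule inj_onI, clarify)
      fix v w v' w' assume v: "v \<in> V" "v' \<in> V" and w: "w \<in> W" "w' \<in> W"
        and eq: "v @ drop l w = v' @ drop l w'"
      have "length v = length v'" using length_B[OF subsetD[OF V(1)]] v by simp
      then have "v = v'" "drop l w = drop l w'" using eq by auto
      then show "v = v' \<and> w = w'" using W(2) w by (metis append_take_drop_id)
    qed
    show "(\<lambda>(v, w). v @ drop l w) ` (V \<times> W) \<subseteq> Y \<inter> B (m + l + m)"
    proof clarify
      fix v w assume v: "v \<in> V" and w: "w \<in> W"
      have len: "length v = m + l" "length w = l + m" 
        using length_B[OF subsetD[OF V(1) v]] length_B[OF subsetD[OF W(1) w]] by auto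
      have vs: "v = take m v @ s" using V(2)[OF v] by (metis append_take_drop_id)
      have ws: "w = s @ drop l w" using W(2)[OF w] by (metis append_take_drop_id)
      have "v \<in> language X" "w \<in> language X" using v w V W len by (auto simp: language_iff)
      then have "take m v @ s @ drop l w \<in> language X"
        using synchronizing vs ws unfolding synchronizing_word_def by metis
      then have eq: "v @ drop l w \<in> language X" by (subst vs) simp
      have "v @ drop l w \<in> B (m + l + m)" using eq len by (simp add: language_iff)
      moreover have "drop m (v @ drop l w) = w" using ws V(2)[OF v] len by simp
      ultimately show "v @ drop l w \<in> Y \<inter> B (m + l + m)" using v w len by (simp add: Y_def)
    qed
  qed simp
  then have "real (card V) * real (card W) \<le> real (card (Y \<inter> B (m + l + m)))"
    by (metis card_cartesian_product of_nat_le_iff of_nat_mult)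
  ultimately have lower: "c\<^sup>2 / N (m + l + m) * (real (card V) * real (card W)) \<le>
      prob (window X (- int m) (m + l) V \<inter> window X 0 (l + m) W)"
    using prob_window_ge[of "m + l + m" Y "- int m"] c_pos
    by (smt (verit) divide_nonneg_pos N_pos mult_left_mono zero_le_power2)
  have V_le: "c\<^sup>2 * N (m + l) * prob (window X (- int m) (m + l) V) \<le> real (card V)"
    using prob_window_le[of "- int m" "m + l" V] V c_pos by (simp add: Int_absorb2 field_simps)
  have W_le: "c\<^sup>2 * N (m + l) * prob (window X 0 (l + m) W) \<le> real (card W)"
    using prob_window_le[of 0 "l + m" W] W c_pos by (simp add: Int_absorb2 field_simps)
  have "c * N m \<le> c * N m * N l" 
    using mult_left_mono[OF N_ge_1[of l], of "c * N m"] c_pos by simp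
  also have "\<dots> \<le> N (m + l)" by (rule N_supermult)
  finally have Nm: "c * N m \<le> N (m + l)" .
  have "c * N (m + l + m) \<le> c * (N (m + l) * N m)"
    using N_submult[of "m + l" m] c_pos by (intro mult_left_mono) auto
  also have "\<dots> \<le> N (m + l) * N (m + l)" using Nm by (simp add: mult.left_commute mult_left_mono)
  finally have Nmlm: "c * N (m + l + m) \<le> N (m + l) * N (m + l)" .
  let ?p = "prob (window X (- int m) (m + l) V)" and ?q = "prob (window X 0 (l + m) W)"
  have "c ^ 7 * ?p * ?q * N (m + l + m) = c ^ 6 * ?p * ?q * (c * N (m + l + m))"
    by (simp add: power_numeral_reduce algebra_simps)
  \<comment> \<open>In the exponent 7, each of the three Gibbs bounds contributes 2, and comparing
    \<open>N (m + l + m)\<close> with the square of \<open>N (m + l)\<close> contributes 1.\<close>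
  also have "\<dots> \<le> c ^ 6 * ?p * ?q * (N (m + l) * N (m + l))"
    using Nmlm c_pos by (intro mult_left_mono) auto
  also have "\<dots> = c\<^sup>2 * ((c\<^sup>2 * N (m + l) * ?p) * (c\<^sup>2 * N (m + l) * ?q))"
    by (simp add: power_numeral_reduce algebra_simps)
  also have "\<dots> \<le> c\<^sup>2 * (real (card V) * real (card W))"
    using V_le W_le c_pos by (intro mult_left_mono mult_mono) auto
  finally have "c ^ 7 * ?p * ?q \<le> c\<^sup>2 / N (m + l + m) * (real (card V) * real (card W))"
    by (simp add: field_simps)
  then show ?thesis using lower by linarith
qed

text \<open>Invariance is asked modulo null sets, since the set it is meant for is a level set of a
  density, itself invariant only almost everywhere.\<close>

definition ae_invariant :: "(int \<Rightarrow> 'a) set \<Rightarrow> bool" where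
  "ae_invariant A \<longleftrightarrow> A \<in> sets M \<and> (\<forall>j. prob (sym_diff A (shift_by j -` A \<inter> X)) = 0)"

lemma preimage_sets [simp]: "A \<in> sets M \<Longrightarrow> shift_by j -` A \<inter> X \<in> sets M"
  using measurable_sets[OF measurable_shift_by, of A] by simp

lemma sub_X: "A \<in> sets M \<Longrightarrow> A \<subseteq> X"
  using sets.sets_into_space by force

lemma ae_invariant_Compl:
  assumes A: "ae_invariant A" shows "ae_invariant (X - A)"
proof -
  have "sym_diff (X - A) (shift_by j -` (X - A) \<inter> X) = sym_diff A (shift_by j -` A \<inter> X)" for j
    using A sub_X[of A] by (auto simp: ae_invariant_def)
  moreover have "X - A \<in> sets M" using A sets.compl_sets[of A M] by (simp add: ae_invariant_def)
  ultimately show ?thesis using A by (simp add: ae_invariant_def)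
qed

text \<open>Up to a null set, an invariant set is determined both by the coordinates far to the left and by
  those far to the right; conditioned on seeing \<open>s\<close>, these are independent up to a constant factor.\<close>

lemma ae_invariant_sync_trivial:
  assumes A: "ae_invariant A"
  shows "prob (A \<inter> cylinder X s 0) = 0 \<or> prob (cylinder X s 0 - A) = 0"
proof (rule ccontr)
  let ?S = "cylinder X s 0"
  define a where "a = prob (A \<inter> ?S)"
  define b where "b = prob (?S - A)"
  assume "\<not> ?thesis"
  then have ab: "0 < a" "0 < b" by (auto simp: a_def b_def zero_less_measure_iff)
  have As [simp]: "A \<in> sets M" using A by (simp add: ae_invariant_def)
  \<comment> \<open>The first two terms preserve half of \<open>a\<close> and \<open>b\<close> under
    approximation; the third makes \<open>2 * e\<close> smaller than the guaranteed measure
    \<open>c ^ 7 * a * b / 4\<close> of the overlap.\<close>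
  define e where "e = min (min (a / 2) (b / 2)) (c ^ 7 * a * b / 16)"
  have e: "0 < e" using ab c_pos by (simp add: e_def)
  obtain C where C: "C \<in> windows X" "prob (sym_diff A C) < e"
    using approx_by_window[OF As e] by blast
  obtain m W where W: "C = window X (- int m) (2 * m) W"
    using windows_symmetricE[OF C(1)] by blast
  \<comment> \<open>Translating the approximating window costs nothing, as neither the measure nor,
    up to a null set, \<open>A\<close> changes under the shift.\<close>
  have near: "prob (sym_diff A (shift_by j -` C \<inter> X)) < e" for j
  proof -
    have Cs: "C \<in> sets M" using C by simp
    have "prob (sym_diff A (shift_by j -` C \<inter> X)) \<le>
        prob (sym_diff A (shift_by j -` A \<inter> X)) + prob (shift_by j -` sym_diff A C \<inter> X)"
      by (intro prob_le_add sets.Un sets.Diff preimage_sets As Cs) auto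
    also have "prob (shift_by j -` sym_diff A C \<inter> X) = prob (sym_diff A C)"
      by (intro prob_shift_by sets.Un sets.Diff As Cs)
    also have "prob (sym_diff A (shift_by j -` A \<inter> X)) = 0" using A by (simp add: ae_invariant_def)
    finally show ?thesis using C by simp
  qed
  \<comment> \<open>\<open>F\<close> reads the coordinates from 0 to \<open>2 * m - 1\<close>, while
    \<open>D\<close> reads those from \<open>- 2 * m\<close> to -1.\<close>
  define F where "F = shift_by (int m) -` C \<inter> X"
  define D where "D = shift_by (- int m) -` C \<inter> X"
  have FD [simp]: "F \<in> sets M" "D \<in> sets M" using C by (simp_all add: F_def D_def)
  have S [simp]: "?S \<in> sets M" by simp
  have F: "F \<inter> ?S = window X 0 (l + 2 * m) {w \<in> B (l + 2 * m). take l w = s \<and> take (2 * m) w \<in> W}"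
    by (auto simp: F_def W window_preimage window_def cylinder_def take_subword)
  have D: "?S - D = window X (- int (2 * m)) (2 * m + l)
      {v \<in> B (2 * m + l). drop (2 * m) v = s \<and> take (2 * m) v \<notin> W}"
  proof -
    have "drop (2 * m) (subword x (- int (2 * m)) (2 * m + l)) = subword x 0 l" for x :: "int \<Rightarrow> 'a"
      using subword_add[of x "- int (2 * m)" "2 * m" l] by simp
    then show ?thesis
      by (auto simp: D_def W window_preimage window_def cylinder_def take_subword)
  qed
  have "a \<le> prob (F \<inter> ?S) + prob (sym_diff A F)"
    unfolding a_def by (intro prob_le_add sets.Un sets.Diff sets.Int As FD S) auto
  then have aF: "a / 2 \<le> prob (F \<inter> ?S)" using near[of "int m"] by (simp add: F_def e_def)
  have "b \<le> prob (?S - D) + prob (sym_diff A D)"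
    unfolding b_def by (intro prob_le_add sets.Un sets.Diff sets.Int As FD S) auto
  then have bD: "b / 2 \<le> prob (?S - D)" using near[of "- int m"] by (simp add: D_def e_def)
  have "c ^ 7 * prob (?S - D) * prob (F \<inter> ?S) \<le> prob ((?S - D) \<inter> (F \<inter> ?S))"
    unfolding F D by (rule prob_sync_product) auto
  moreover have "c ^ 7 * (b / 2) * (a / 2) \<le> c ^ 7 * prob (?S - D) * prob (F \<inter> ?S)"
    using aF bD ab c_pos by (intro mult_mono mult_left_mono) auto
  \<comment> \<open>A point of \<open>F\<close> outside \<open>D\<close> is misjudged by
    \<open>D\<close> if it lies in \<open>A\<close>, and by \<open>F\<close> otherwise.\<close>
  moreover have "prob ((?S - D) \<inter> (F \<inter> ?S)) \<le> prob (sym_diff A F) + prob (sym_diff A D)"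
    by (intro prob_le_add sets.Un sets.Diff As FD) auto
  moreover have "prob (sym_diff A F) < e" "prob (sym_diff A D) < e"
    using near[of "int m"] near[of "- int m"] by (simp_all add: F_def D_def)
  moreover have "e \<le> c ^ 7 * a * b / 16" by (simp add: e_def)
  moreover have "0 < c ^ 7 * a * b" using ab c_pos by simp
  ultimately show False by (simp add: algebra_simps)
qed

section \<open>Almost every point sees the synchronizing word\<close>

text \<open>Return is excluded only from time \<open>k\<close> on, so the preimages are taken at
  multiples of \<open>k\<close>: these are disjoint, equally large, and infinitely many.\<close>

lemma poincare_recurrence:
  assumes E: "E \<in> sets M" and k: "1 \<le> k"
    and no_return: "\<And>x j. x \<in> E \<Longrightarrow> k \<le> j \<Longrightarrow> shift_by (int j) x \<notin> E"
  shows "prob E = 0"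
proof -
  define A where "A i = shift_by (int (i * k)) -` E \<inter> X" for i :: nat
  have meas: "A i \<in> sets M" "prob (A i) = prob E" for i
    using E prob_shift_by by (auto simp: A_def)
  have "A i \<inter> A j = {}" if "i < j" for i j
  proof -
    have "shift_by (int (i * k)) x \<notin> E" if "shift_by (int (j * k)) x \<in> E" for x
    proof
      assume "shift_by (int (i * k)) x \<in> E"
      moreover have "k \<le> (j - i) * k" using \<open>i < j\<close> by (cases "j - i") auto
      ultimately have "shift_by (int ((j - i) * k)) (shift_by (int (i * k)) x) \<notin> E"
        by (rule no_return)
      moreover have "int ((j - i) * k) + int (i * k) = int (j * k)"
        using \<open>i < j\<close> by (simp flip: of_nat_add add: diff_mult_distrib)
      ultimately show False using that by (metis shift_by_simps(2))
    qed
    then show ?thesis by (auto simp: A_def)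
  qed
  then have "disjoint_family A"
    by (auto simp: disjoint_family_on_def) (metis disjoint_iff linorder_neqE_nat)
  then have "(\<lambda>i. prob (A i)) sums prob (\<Union>i. A i)"
    using meas by (intro finite_measure_UNION) auto
  then show ?thesis using meas by (simp add: sums_iff summable_const_iff)
qed

definition avoiding :: "(int \<Rightarrow> 'a) set" where
  "avoiding = X - (\<Union>j. cylinder X s j)"

lemma avoiding_sets [simp]: "avoiding \<in> sets M"
proof -
  have "X \<in> sets M" using sets.top[of M] by simp
  then show ?thesis unfolding avoiding_def by (intro sets.Diff sets.countable_UN) auto
qed

abbreviation sees :: "'a list \<Rightarrow> bool" where
  "sees v \<equiv> \<exists>i. i + l \<le> length v \<and> take l (drop i v) = s"

text \<open>The extensions of \<open>s @ w @ u\<close> are among those of \<open>u\<close>, they are at least a proportion \<open>c\<close> of all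
  words, and by recurrence most of them contain \<open>s\<close> again.\<close>

lemma prob_cylinder_avoiding:
  assumes u: "u \<in> B k"
  shows "prob (cylinder X u 0 \<inter> avoiding) \<le> (1 - c ^ 5 / 2) * P u"
proof -
  have uL: "u \<in> language X" "length u = k" using u length_B by (auto simp: language_iff)
  obtain w where "s @ w @ u \<in> language X"
    using irreducible uL synchronizing unfolding irreducible_shift_def synchronizing_word_def by blast
  \<comment> \<open>With \<open>s\<close> in front of \<open>t\<close>, a return to the cylinder of
    \<open>t\<close> is itself an occurrence of \<open>s\<close>, which makes recurrence
    applicable.\<close>
  define t where "t = s @ w @ u"
  define r where "r = length t"
  have t: "t \<in> language X" using \<open>s @ w @ u \<in> language X\<close> by (simp add: t_def)
  define Z where "Z n = {x \<in> X. subword x 0 r = t \<and> (\<forall>i. i + l \<le> n \<longrightarrow> subword x (int (r + i)) l \<noteq> s)}" for n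
  have Z_window: "Z n = window X 0 (r + n) {y. take r y = t \<and> \<not> sees (drop r y)}" for n
  proof -
    have "drop r (subword x 0 (r + n)) = subword x (int r) n" for x :: "int \<Rightarrow> 'a"
      using subword_add[of x 0 r n] by simp
    moreover have "take l (drop i (subword x (int r) n)) = subword x (int (r + i)) l"
      if "i + l \<le> n" for i and x :: "int \<Rightarrow> 'a"
      using take_drop_subword[OF that, of x "int r"] by simp
    ultimately have "sees (drop r (subword x 0 (r + n))) \<longleftrightarrow> (\<exists>i. i + l \<le> n \<and> subword x (int (r + i)) l = s)"
      for x :: "int \<Rightarrow> 'a"
      by (metis length_subword)
    note sees_iff = this
    show ?thesis
      unfolding Z_def window_def mem_Collect_eq sees_iff take_subword[OF le_add1] by blast
  qed
  have Zs [simp]: "Z n \<in> sets M" for n by (simp add: Z_window)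
  have "decseq Z" by (rule decseq_SucI) (auto simp: Z_def)
  then have "(\<lambda>n. prob (Z n)) \<longlonglongrightarrow> prob (\<Inter>n. Z n)"
    by (intro finite_Lim_measure_decseq) auto
  moreover have "prob (\<Inter>n. Z n) = 0"
  \<comment> \<open>A return at time \<open>j > r\<close> would show \<open>s\<close> at coordinate
    \<open>j\<close>, beyond the initial \<open>t\<close>, where points of the intersection have
    none.\<close>
  proof (rule poincare_recurrence[of _ "Suc r"])
    show "(\<Inter>n. Z n) \<in> sets M" by (intro sets.countable_INT) auto
    fix x j assume x: "x \<in> (\<Inter>n. Z n)" and j: "Suc r \<le> j"
    then have "x \<in> Z (j - r + l)" by blast
    then have "subword x (int (r + (j - r))) l \<noteq> s" unfolding Z_def by blast
    then have ne: "subword x (int j) l \<noteq> s" using j by simp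
    show "shift_by (int j) x \<notin> (\<Inter>n. Z n)"
    proof
      assume "shift_by (int j) x \<in> (\<Inter>n. Z n)"
      then have "subword x (int j) r = t" by (auto simp: Z_def)
      then have "subword x (int j) l = take l t"
        using take_subword[of l r x "int j"] by (simp add: r_def t_def)
      then show False using ne by (simp add: t_def)
    qed
  qed simp
  ultimately have "(\<lambda>n. prob (Z n)) \<longlonglongrightarrow> 0" by simp
  \<comment> \<open>The threshold makes the continuations of \<open>t\<close> without
    \<open>s\<close> number at most \<open>c * N n / 2\<close>, half of the \<open>c * N n\<close>
    continuations that balancedness guarantees.\<close>
  then have "\<forall>\<^sub>F n in sequentially. prob (Z n) < c ^ 3 / (2 * N r)"
    using c_pos by (intro order_tendstoD) auto
  then obtain n where n: "prob (Z n) < c ^ 3 / (2 * N r)" by (auto simp: eventually_sequentially)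
  define Q where "Q = {v \<in> B n. t @ v \<in> language X}"
  have inj: "inj_on ((@) x) A" for x :: "'a list" and A by (simp add: inj_on_def)
  have Q_app: "v \<in> Q \<Longrightarrow> t @ v \<in> B (r + n)" for v
    using length_B by (auto simp: Q_def language_iff r_def)
  have "c\<^sup>2 / N (r + n) * real (card {v \<in> Q. \<not> sees v}) \<le> prob (Z n)"
  proof -
    have "card {v \<in> Q. \<not> sees v} \<le> card ({y. take r y = t \<and> \<not> sees (drop r y)} \<inter> B (r + n))"
      by (rule card_inj_on_le[OF inj[of t]]) (use Q_app in \<open>auto simp: r_def\<close>)
    then have "c\<^sup>2 / N (r + n) * real (card {v \<in> Q. \<not> sees v}) \<le>
       c\<^sup>2 / N (r + n) * real (card ({y. take r y = t \<and> \<not> sees (drop r y)} \<inter> B (r + n)))"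
      by (intro mult_left_mono) auto
    also have "\<dots> \<le> prob (Z n)" unfolding Z_window by (rule prob_window_ge)
    finally show ?thesis .
  qed
  then have "c\<^sup>2 / N (r + n) * real (card {v \<in> Q. \<not> sees v}) \<le> c ^ 3 / (2 * N r)" using n by simp
  then have "c\<^sup>2 * (real (card {v \<in> Q. \<not> sees v}) * (2 * N r)) \<le> c\<^sup>2 * (c * N (r + n))"
    by (simp add: field_simps power2_eq_square power3_eq_cube)
  then have "real (card {v \<in> Q. \<not> sees v}) * (2 * N r) \<le> c * N (r + n)" using c_pos by simp
  also have "\<dots> \<le> c * (N r * N n)" using c_pos by (intro mult_left_mono N_submult) auto
  finally have "N r * (2 * real (card {v \<in> Q. \<not> sees v})) \<le> N r * (c * N n)"
    by (simp add: algebra_simps)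
  then have unseen: "2 * real (card {v \<in> Q. \<not> sees v}) \<le> c * N n" by simp
  have "c * N n \<le> real (card Q)" unfolding Q_def by (rule followers[OF t])
  moreover have "card Q = card {v \<in> Q. sees v} + card {v \<in> Q. \<not> sees v}"
    by (subst card_Un_disjoint[symmetric]) (auto simp: Q_def intro!: arg_cong[of _ _ card])
  ultimately have seen: "c * N n \<le> 2 * real (card {v \<in> Q. sees v})" using unseen by simp
  \<comment> \<open>Since \<open>u\<close> is a suffix of \<open>t\<close>, the continuations found
    for \<open>t\<close> are transferred to \<open>u\<close>; \<open>r\<close>, and with it the
    length of \<open>w\<close>, leaves the estimate here.\<close>
  let ?Y = "{y. take k y = u \<and> sees (drop k y)}"
  have "card {v \<in> Q. sees v} \<le> card (?Y \<inter> B (k + n))"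
  proof (rule card_inj_on_le[OF inj[of u]])
    show "(@) u ` {v \<in> Q. sees v} \<subseteq> ?Y \<inter> B (k + n)"
    proof (rule image_subsetI)
      fix v assume "v \<in> {v \<in> Q. sees v}"
      then obtain i where v: "v \<in> Q" and i: "i + l \<le> length v" "take l (drop i v) = s" by blast
      have "u @ v \<in> language X"
        using v language_appendD(2)[of "s @ w" "u @ v"] by (simp add: Q_def t_def)
      then have "u @ v \<in> B (k + n)" using v uL length_B by (auto simp: language_iff Q_def)
      then show "u @ v \<in> ?Y \<inter> B (k + n)" using i uL by auto
    qed
  qed simp
  then have "c\<^sup>2 / N (k + n) * (c * N n / 2) \<le> c\<^sup>2 / N (k + n) * real (card (?Y \<inter> B (k + n)))"
    using seen by (intro mult_left_mono) auto
  also have "\<dots> \<le> prob (window X 0 (k + n) ?Y)" by (rule prob_window_ge)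
  also have "\<dots> \<le> prob (cylinder X u 0 - avoiding)"
  proof (rule finite_measure_mono)
    show "window X 0 (k + n) ?Y \<subseteq> cylinder X u 0 - avoiding"
    proof
      fix x assume x: "x \<in> window X 0 (k + n) ?Y"
      then have xX: "x \<in> X" and xu: "subword x 0 k = u" and "sees (drop k (subword x 0 (k + n)))"
        by (auto simp: window_def take_subword)
      then obtain i where i: "i + l \<le> n" "take l (drop (i + k) (subword x 0 (k + n))) = s" by auto
      then have "subword x (int (i + k)) l = s" using take_drop_subword[of "i + k" l "k + n" x 0] by simp
      then have "x \<in> cylinder X s (int (i + k))" using xX by (simp add: cylinder_def)
      then show "x \<in> cylinder X u 0 - avoiding" using xX xu uL by (auto simp: avoiding_def cylinder_def)
    qed
  qed auto
  finally have lower: "c\<^sup>2 / N (k + n) * (c * N n / 2) \<le> prob (cylinder X u 0 - avoiding)" .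
  \<comment> \<open>The power of \<open>c\<close> collects 2 from the lower and 2 from the upper
    Gibbs bound and 1 from the number of continuations. The length \<open>n\<close> depends on
    \<open>u\<close>, but the constant does not.\<close>
  have "c ^ 5 / 2 * P u \<le> c ^ 5 / 2 * (1 / (c\<^sup>2 * N k))"
    using gibbs_le[OF u] c_pos by (intro mult_left_mono) auto
  also have "\<dots> = c ^ 3 * N n / (2 * (N k * N n))"
    using c_pos by (simp add: power_numeral_reduce field_simps)
  also have "\<dots> \<le> c ^ 3 * N n / (2 * N (k + n))"
    using c_pos N_submult[of k n] by (intro divide_left_mono) auto
  also have "\<dots> = c\<^sup>2 / N (k + n) * (c * N n / 2)" by (simp add: power_numeral_reduce)
  finally have "c ^ 5 / 2 * P u \<le> prob (cylinder X u 0 - avoiding)" using lower by simp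
  moreover have "prob (cylinder X u 0 - avoiding) = P u - prob (cylinder X u 0 \<inter> avoiding)"
    by (rule finite_measure_Diff') auto
  ultimately show ?thesis by (simp add: algebra_simps)
qed

text \<open>The set fills at most a fixed share \<open>1 - d < 1\<close> of every window. Windows
  approximating the set itself would be filled almost completely if it had positive measure.\<close>

lemma avoiding_null: "prob avoiding = 0"
proof -
  define d where "d = c ^ 5 / 2"
  have d: "0 < d" "d \<le> 1" using c_pos c_le_1 power_le_one[of c 5] by (auto simp: d_def)
  have win: "prob (C \<inter> avoiding) \<le> (1 - d) * prob C" if C: "C \<in> windows X" for C
  proof -
    obtain a n W where CW: "C = window X a n W" using C by (auto simp: windows_def)
    have shift: "prob (cylinder X w a \<inter> avoiding) = prob (cylinder X w 0 \<inter> avoiding)" for w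
    proof -
      have "shift_by a x \<in> avoiding \<longleftrightarrow> x \<in> avoiding" for x
      proof -
        have "(\<exists>j. subword x (j + a) l = s) \<longleftrightarrow> (\<exists>j. subword x j l = s)"
          by (metis diff_add_cancel)
        then show ?thesis by (auto simp: avoiding_def cylinder_def)
      qed
      then have "cylinder X w a \<inter> avoiding = shift_by a -` (cylinder X w 0 \<inter> avoiding) \<inter> X"
        by (auto simp: cylinder_def)
      also have "prob \<dots> = prob (cylinder X w 0 \<inter> avoiding)" by (rule prob_shift_by) auto
      finally show ?thesis .
    qed
    have "C \<inter> avoiding = (\<Union>w\<in>W \<inter> B n. cylinder X w a \<inter> avoiding)"
      by (auto simp: CW window_eq_UN)
    then have "prob (C \<inter> avoiding) \<le> (\<Sum>w\<in>W \<inter> B n. prob (cylinder X w a \<inter> avoiding))"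
      by (simp only:) (rule measure_UNION_le, auto)
    also have "\<dots> \<le> (\<Sum>w\<in>W \<inter> B n. (1 - d) * P w)"
      unfolding shift d_def by (intro sum_mono prob_cylinder_avoiding) auto
    also have "\<dots> = (1 - d) * prob C" by (simp add: CW prob_window sum_distrib_left)
    finally show ?thesis .
  qed
  have "d * prob avoiding \<le> 2 * e" if e: "0 < e" for e
  proof -
    obtain C where C: "C \<in> windows X" "prob (sym_diff avoiding C) < e"
      using approx_by_window[OF avoiding_sets e] by blast
    have Cs: "C \<in> sets M" using C by simp
    have 1: "prob avoiding \<le> prob (C \<inter> avoiding) + prob (sym_diff avoiding C)"
      by (intro prob_le_add sets.Un sets.Diff sets.Int avoiding_sets Cs) auto
    have "prob C \<le> prob avoiding + prob (sym_diff avoiding C)"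
      by (intro prob_le_add sets.Un sets.Diff sets.Int avoiding_sets Cs) auto
    then have "prob C \<le> prob avoiding + e" using C by simp
    then have "(1 - d) * prob C \<le> (1 - d) * (prob avoiding + e)" using d by (intro mult_left_mono) auto
    also have "\<dots> \<le> (1 - d) * prob avoiding + e" using d e by (simp add: algebra_simps)
    finally show ?thesis using win[OF C(1)] 1 C(2) by (simp add: algebra_simps)
  qed
  \<comment> \<open>With this \<open>e\<close>, the inequality would say that a positive number is
    at most half of itself.\<close>
  from this[of "d * prob avoiding / 4"] have "d * prob avoiding \<le> 0"
    by (cases "0 < d * prob avoiding") auto
  then show ?thesis using d by (simp add: mult_le_0_iff measure_le_0_iff)
qed

text \<open>Invariance carries the null intersection to the cylinder of \<open>s\<close> at every
  coordinate, and these countably many cylinders cover \<open>X\<close> up to the null set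
  \<open>avoiding\<close>.\<close>

lemma ae_invariant_null:
  assumes A: "ae_invariant A" and null: "prob (A \<inter> cylinder X s 0) = 0"
  shows "prob A = 0"
proof -
  have As [simp]: "A \<in> sets M" using A by (simp add: ae_invariant_def)
  have AS: "A \<inter> cylinder X s 0 \<in> sets M" by auto
  have "A \<inter> cylinder X s j \<in> null_sets M" for j
  proof -
    have eq: "cylinder X s j = shift_by j -` cylinder X s 0 \<inter> X" by (auto simp: cylinder_def)
    have "prob (A \<inter> cylinder X s j) \<le>
        prob (sym_diff A (shift_by j -` A \<inter> X)) + prob (shift_by j -` (A \<inter> cylinder X s 0) \<inter> X)"
      by (intro prob_le_add sets.Un sets.Diff preimage_sets As AS) (auto simp: eq)
    also have "\<dots> = 0" using A null prob_shift_by[OF AS] by (simp add: ae_invariant_def)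
    finally show ?thesis by (auto simp: null_sets_def emeasure_eq_measure measure_le_0_iff)
  qed
  then have "(\<Union>j. A \<inter> cylinder X s j) \<in> null_sets M" by (intro null_sets_UN) auto
  moreover have "avoiding \<in> null_sets M"
    using avoiding_null by (auto simp: null_sets_def emeasure_eq_measure)
  ultimately have "(\<Union>j. A \<inter> cylinder X s j) \<union> avoiding \<in> null_sets M" by auto
  moreover have "A \<subseteq> (\<Union>j. A \<inter> cylinder X s j) \<union> avoiding"
    using sub_X[OF As] by (auto simp: avoiding_def)
  ultimately have "A \<in> null_sets M" using As null_sets_subset by blast
  then show ?thesis by (simp add: measure_eq_0_null_sets)
qed

theorem ergodic:
  assumes A: "ae_invariant A"
  shows "prob A = 0 \<or> prob (X - A) = 0"
proof -
  have "(X - A) \<inter> cylinder X s 0 = cylinder X s 0 - A" by (auto simp: cylinder_def)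
  then show ?thesis
    using ae_invariant_sync_trivial[OF A] ae_invariant_null[OF A] ae_invariant_null[OF ae_invariant_Compl[OF A]]
    by auto
qed

end

section \<open>Uniqueness\<close>

context synchronized_gibbs_measure
begin

text \<open>Ergodicity puts the density of \<nu> almost everywhere on one side of 1. This orders two
  measures of equal total mass, and they must then coincide.\<close>

lemma max_entropy_unique:
  assumes \<nu>: "measure_of_maximal_entropy X \<nu>"
  shows "\<nu> = M"
proof -
  interpret \<nu>: shift_measure X \<nu>
    using \<nu> by unfold_locales (simp add: measure_of_maximal_entropy_def)
  have sets_eq [measurable_cong]: "sets \<nu> = sets M" by (simp add: sets_M \<nu>.sets_M)
  define f where "f = RN_deriv M \<nu>"
  have f [measurable]: "f \<in> borel_measurable M" by (simp add: f_def)
  have dens: "density M f = \<nu>"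
    unfolding f_def by (rule density_RN_deriv[OF max_entropy_absolutely_continuous[OF \<nu>] sets_eq])
  have em: "emeasure \<nu> E = (\<integral>\<^sup>+x. f x * indicator E x \<partial>M)" if "E \<in> sets M" for E
    using emeasure_density[OF f that] by (simp add: dens)
  have distr: "distr M M (shift_by j) = M" for j
    by (rule measure_eqI) (simp_all add: emeasure_distr emeasure_shift_by)
  have f_inv: "AE x in M. f (shift_by j x) = f x" for j
  proof -
    have fj [measurable]: "(\<lambda>x. f (shift_by j x)) \<in> borel_measurable M" by measurable
    \<comment> \<open>Both sides are \<nu>, by invariance of the two measures; uniqueness of
      densities then makes \<open>f\<close> invariant almost everywhere.\<close>
    have "density M (\<lambda>x. f (shift_by j x)) = density M f"
    proof (rule measure_eqI)
      fix E assume "E \<in> sets (density M (\<lambda>x. f (shift_by j x)))"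
      then have E: "E \<in> sets M" by simp
      define E' where "E' = shift_by (- j) -` E \<inter> X"
      have E' [measurable]: "E' \<in> sets M" unfolding E'_def using E by (rule preimage_sets)
      have "emeasure (density M (\<lambda>x. f (shift_by j x))) E = (\<integral>\<^sup>+x. f (shift_by j x) * indicator E x \<partial>M)"
        using E by (simp add: emeasure_density)
      also have "\<dots> = (\<integral>\<^sup>+x. f (shift_by j x) * indicator E' (shift_by j x) \<partial>M)"
        by (rule nn_integral_cong) (simp add: E'_def indicator_def)
      also have "\<dots> = (\<integral>\<^sup>+x. f x * indicator E' x \<partial>distr M M (shift_by j))"
        by (subst nn_integral_distr) auto
      also have "\<dots> = emeasure \<nu> E'" by (simp add: distr em)
      also have "\<dots> = emeasure \<nu> E"
        unfolding E'_def by (rule \<nu>.emeasure_shift_by) (use E sets_eq in simp)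
      finally show "emeasure (density M (\<lambda>x. f (shift_by j x))) E = emeasure (density M f) E"
        by (simp add: dens)
    qed simp
    then show ?thesis using density_unique_iff[OF fj f] by simp
  qed
  define A where "A = {x \<in> X. 1 < f x}"
  have A_sets [measurable]: "A \<in> sets M"
  proof -
    have "{x \<in> space M. 1 < f x} \<in> sets M" by measurable
    then show ?thesis by (simp add: A_def)
  qed
  have "ae_invariant A"
    unfolding ae_invariant_def
  proof (intro conjI allI A_sets)
    fix j
    have "AE x in M. x \<notin> sym_diff A (shift_by j -` A \<inter> X)"
      using f_inv[of j] by eventually_elim (auto simp: A_def)
    moreover have "sym_diff A (shift_by j -` A \<inter> X) \<in> sets M"
      by (intro sets.Un sets.Diff preimage_sets A_sets)
    ultimately show "prob (sym_diff A (shift_by j -` A \<inter> X)) = 0"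
      using prob_eq_0 by blast
  qed
  then consider "prob A = 0" | "prob (X - A) = 0" using ergodic by blast
  then show ?thesis
  proof cases
    case 1
    then have "AE x in M. x \<notin> A" by (subst (asm) prob_eq_0) auto
    then have f_le: "AE x in M. f x \<le> 1"
      using AE_space by eventually_elim (auto simp: A_def not_less)
    have le: "\<nu>.prob E \<le> prob E" if E: "E \<in> sets M" for E
    proof -
      have "emeasure \<nu> E \<le> (\<integral>\<^sup>+x. indicator E x \<partial>M)"
        unfolding em[OF E] using f_le
        by (intro nn_integral_mono_AE) (auto elim!: eventually_mono simp: indicator_def)
      then show ?thesis using E by (simp add: emeasure_eq_measure \<nu>.emeasure_eq_measure)
    qed
    show ?thesis
    proof (rule measure_eqI)
      fix E assume "E \<in> sets \<nu>"
      then have E: "E \<in> sets M" by (simp add: sets_eq)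
      \<comment> \<open>The same one-sided inequality at the complement yields the reverse
        inequality at \<open>E\<close>.\<close>
      have "\<nu>.prob (X - E) \<le> prob (X - E)" using le sets.compl_sets[OF E] by simp
      then have "1 - \<nu>.prob E \<le> 1 - prob E"
        using prob_compl[OF E] \<nu>.prob_compl[of E] E sets_eq by simp
      then show "emeasure \<nu> E = emeasure M E"
        using le[OF E] by (simp add: emeasure_eq_measure \<nu>.emeasure_eq_measure)
    qed (rule sets_eq)
  next
    case 2
    have "X - A \<in> sets M" using sets.compl_sets[OF A_sets] by simp
    then have "AE x in M. x \<notin> X - A" using 2 by (subst (asm) prob_eq_0) auto
    then have f_ge: "AE x in M. 1 \<le> f x"
      using AE_space by eventually_elim (auto simp: A_def)
    have le: "prob E \<le> \<nu>.prob E" if E: "E \<in> sets M" for E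
    proof -
      have "(\<integral>\<^sup>+x. indicator E x \<partial>M) \<le> emeasure \<nu> E"
        unfolding em[OF E] using f_ge
        by (intro nn_integral_mono_AE) (auto elim!: eventually_mono simp: indicator_def)
      then show ?thesis using E by (simp add: emeasure_eq_measure \<nu>.emeasure_eq_measure)
    qed
    show ?thesis
    proof (rule measure_eqI)
      fix E assume "E \<in> sets \<nu>"
      then have E: "E \<in> sets M" by (simp add: sets_eq)
      have "prob (X - E) \<le> \<nu>.prob (X - E)" using le sets.compl_sets[OF E] by simp
      then have "1 - prob E \<le> 1 - \<nu>.prob E"
        using prob_compl[OF E] \<nu>.prob_compl[of E] E sets_eq by simp
      then show "emeasure \<nu> E = emeasure M E"
        using le[OF E] by (simp add: emeasure_eq_measure \<nu>.emeasure_eq_measure)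
    qed (rule sets_eq)
  qed
qed

end

lemma balanced_shift_exists:
  fixes X :: "(int \<Rightarrow> 'a::finite) set"
  assumes "shift_space X" "bi_balanced X"
  obtains c where "balanced_shift X c"
proof -
  interpret subshift X by unfold_locales (rule assms)
  obtain c1 where c1: "c1 > 0" "\<And>u n. u \<in> language X \<Longrightarrow> n \<ge> 1 \<Longrightarrow> c1 \<le> real (card (follower_words n u X)) / N n"
    using assms(2) unfolding bi_balanced_def right_balanced_def by blast
  obtain c2 where c2: "c2 > 0" "\<And>u n. u \<in> language X \<Longrightarrow> n \<ge> 1 \<Longrightarrow> c2 \<le> real (card (predecessor_words n u X)) / N n"
    using assms(2) unfolding bi_balanced_def left_balanced_def by blast
  \<comment> \<open>The 1 in the minimum handles \<open>n = 0\<close>, a length on which the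
    definition of balancedness is silent and where the empty word is the only continuation.\<close>
  define c where "c = min 1 (min c1 c2)"
  have "balanced_shift X c"
  proof
    show "0 < c" "c \<le> 1" using c1 c2 by (auto simp: c_def)
  next
    fix u n assume u: "u \<in> language X"
    then have "{v. v = [] \<and> u @ v \<in> language X} = {[]}" "{v. v = [] \<and> v @ u \<in> language X} = {[]}"
      by auto
    note zero = this
    show "c * N n \<le> real (card {v \<in> B n. u @ v \<in> language X})"
    proof (cases "n = 0")
      case False
      then have "c \<le> real (card (follower_words n u X)) / N n"
        using c1(2)[OF u, of n] by (simp add: c_def)
      then show ?thesis by (simp add: le_divide_eq follower_words_def)
    qed (simp add: c_def zero)
    show "c * N n \<le> real (card {v \<in> B n. v @ u \<in> language X})"
    proof (cases "n = 0")
      case False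
      then have "c \<le> real (card (predecessor_words n u X)) / N n"
        using c2(2)[OF u, of n] by (simp add: c_def)
      then show ?thesis by (simp add: le_divide_eq predecessor_words_def)
    qed (simp add: c_def zero)
  qed
  then show ?thesis by (rule that)
qed

theorem corollary4p8:
  fixes X :: "(int \<Rightarrow> 'a::finite) set"
  assumes "shift_space X"
    and "synchronized_shift X"
    and "bi_balanced X"
  shows "intrinsically_ergodic X"
proof -
  obtain c where "balanced_shift X c"
    using balanced_shift_exists[OF assms(1,3)] .
  then obtain M where "gibbs_measure X c M"
    using balanced_shift.gibbs_measure_exists by blast
  moreover obtain s where "synchronizing_word X s" and "irreducible_shift X"
    using assms(2) by (auto simp: synchronized_shift_def)
  ultimately interpret synchronized_gibbs_measure X c M s
    by (simp add: synchronized_gibbs_measure_def synchronized_gibbs_measure_axioms_def)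
  show ?thesis
    unfolding intrinsically_ergodic_def using max_entropy max_entropy_unique by blast
qed

end
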